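(* Let $(\omega_{n})_{n=1}^{\infty}$ be a sequence of real numbers with $\omega_n\to\infty$. Then for Lebesgue almost every $\beta\in(1.497\ldots,2)$ the set $V_{\beta}(\Psi)$ with $\Psi(n)=\omega_{n}\cdot 2^{-n}$ is of full Lebesgue measure within $[0,1]$.
   Context: For $\beta\in(1,2)$ and $\Psi:\mathbb{N}\to\mathbb{R}_{\geq0}$ define $$V_{\beta}(\Psi):=\bigcap_{m=1}^{\infty}\bigcup_{n=m}^{\infty}\bigcup_{(\epsilon_{i})_{i=1}^{n}\in\{0,1\}^{n}}\Big[(\beta-1)\sum_{i=1}^{n}\frac{\epsilon_{i}}{\beta^{i}},(\beta-1)\sum_{i=1}^{n}\frac{\epsilon_{i}}{\beta^{i}}+\Psi(n)\Big].$$ The number $1.497\ldots$ is a specific constant (the lower endpoint of the interval of $\beta$ on which the transversality-based counting estimates of Benjamini and Solomyak hold). *)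

theory Defs
  imports "HOL-Analysis.Analysis"
begin

text \<open>
  The threshold written \<open>1.497...\<close>: Benjamini and Solomyak parametrise Bernoulli
  convolutions by \<open>r = 1 / \<beta>\<close> and work on the transversality interval
  \<open>1 / 2 < r < 0.668\<close>; the corresponding range of \<open>\<beta>\<close> is \<open>1 / 0.668 < \<beta> < 2\<close>.
\<close>

definition beta_BS :: real where
  "beta_BS = 1 / 0.668"

lemma beta_BS_bounds: "1.497 < beta_BS" "beta_BS < 1.4971"
  by (simp_all add: beta_BS_def field_simps)

text \<open>
  A word of length \<open>n\<close> over \<open>{0, 1}\<close> is an extensional function on \<open>{1..n}\<close>. If \<open>\<Psi> n < 0\<close>,
  the intervals of level \<open>n\<close> are empty.
\<close>

definition V :: "real \<Rightarrow> (nat \<Rightarrow> real) \<Rightarrow> real set" where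
  "V \<beta> \<Psi> = (\<Inter>m\<in>{1..}. \<Union>n\<in>{m..}. \<Union>\<epsilon>\<in>{1..n} \<rightarrow>\<^sub>E {0, 1}.
     {(\<beta> - 1) * (\<Sum>i=1..n. \<epsilon> i / \<beta> ^ i) .. (\<beta> - 1) * (\<Sum>i=1..n. \<epsilon> i / \<beta> ^ i) + \<Psi> n})"

end

theory Submission
  imports Defs
begin

text \<open>
  Write \<open>x = 1 / \<beta>\<close>. No power series with coefficients in \<open>{-1, 0, 1}\<close> and constant term \<open>1\<close> has
  a double zero in \<open>[1/2, 0.668]\<close>, quantitatively: \<open>\<bar>f\<bar>\<close> and \<open>\<bar>f'\<bar>\<close> are never both small. Hence two
  words of length \<open>n\<close> that first differ at place \<open>k\<close> have points within \<open>s / 2 ^ n\<close> only for a set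
  of \<open>\<beta>\<close> of measure \<open>O(s \<beta> ^ k / 2 ^ n)\<close>. Summing over pairs (this needs \<open>\<beta> < 2\<close>), the expected
  number of close pairs is \<open>O(s 2 ^ n)\<close>. So for almost every \<open>\<beta>\<close> there is a small \<open>s\<close> such that, for
  infinitely many \<open>n\<close>, half of the words are isolated at scale \<open>s / 2 ^ n\<close>, and the limsup set
  for \<open>\<Psi> n = s / 2 ^ n\<close> has measure at least \<open>s / 2\<close>. The union over \<open>s\<close> of these limsup sets is
  mapped into itself by the two contractions generating the expansions, so it has proportion
  bounded below in every subinterval of \<open>[0, 1]\<close>, which forces full measure. As \<open>\<omega> n \<rightarrow> \<infinity>\<close>, it is
  contained in \<open>V\<close>.
\<close>

section \<open>Transversality\<close>

text \<open>
  The integers \<open>(u, v, S, T, P)\<close> stand for the constraints \<open>\<bar>u + P g\<bar> \<le> S\<close> and \<open>\<bar>v + P \<theta>g\<bar> \<le> T\<close> at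
  \<open>x = p / q\<close>, where \<open>g\<close> is the unknown tail of the series and \<open>\<theta> = x d/dx\<close>. A leaf is closed by
  \<open>\<bar>g\<bar> \<le> 1 / (1 - x)\<close> or \<open>\<bar>\<theta>g\<bar> \<le> x / (1 - x)\<^sup>2\<close>; otherwise \<open>g = a + x h\<close> branches over the digit \<open>a\<close>,
  everything being scaled by \<open>p\<close> to stay integral.
\<close>

fun excl :: "int \<Rightarrow> int \<Rightarrow> nat \<Rightarrow> int \<Rightarrow> int \<Rightarrow> int \<Rightarrow> int \<Rightarrow> int \<Rightarrow> bool" where
  "excl p q 0 u v S T P = False"
| "excl p q (Suc n) u v S T P \<longleftrightarrow>
     q * P + (q - p) * S < (q - p) * \<bar>u\<bar> \<or>
     p * q * P + (q - p)\<^sup>2 * T < (q - p)\<^sup>2 * \<bar>v\<bar> \<or>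
     (excl p q n (q * (u - P)) (q * (v - u + P)) (q * S) (q * (T + S)) (p * P) \<and>
      excl p q n (q * u) (q * (v - u)) (q * S) (q * (T + S)) (p * P) \<and>
      excl p q n (q * (u + P)) (q * (v - u - P)) (q * S) (q * (T + S)) (p * P))"

section \<open>Sums of powers and soundness of the exclusion search\<close>

lemma sum_power_le:
  fixes x :: real
  assumes "0 \<le> x" "x < 1"
  shows "(\<Sum>i<n. x ^ i) \<le> 1 / (1 - x)"
proof -
  have "(1 - x) * (\<Sum>i<n. x ^ i) \<le> 1"
    unfolding one_diff_power_eq[symmetric] using assms by simp
  then show ?thesis using assms by (simp add: field_simps)
qed

text \<open>Multiplication by \<open>1 - x\<close> telescopes the weights down to those of the plain
  geometric sum, minus a nonnegative boundary term.\<close>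

lemma sum_Suc_power_le:
  fixes x :: real
  assumes "0 \<le> x" "x < 1"
  shows "(\<Sum>i<n. (real i + 1) * x ^ i) \<le> 1 / (1 - x)\<^sup>2"
proof -
  have "(1 - x) * (\<Sum>i<n. (real i + 1) * x ^ i) = (\<Sum>i<n. x ^ i) - real n * x ^ n"
  proof (induction n)
    case (Suc n)
    show ?case unfolding sum.lessThan_Suc distrib_left Suc.IH by (simp add: algebra_simps)
  qed simp
  also have "\<dots> \<le> 1 / (1 - x)"
    using sum_power_le[OF assms, of n] assms by (smt (verit) mult_nonneg_nonneg of_nat_0_le_iff zero_le_power)
  finally have "(\<Sum>i<n. (real i + 1) * x ^ i) \<le> 1 / (1 - x) / (1 - x)"
    using assms by (simp add: pos_le_divide_eq mult.commute)
  also have "\<dots> = 1 / (1 - x)\<^sup>2" by (simp add: power2_eq_square)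
  finally show ?thesis .
qed

lemma sum_Suc_Suc_power_le:
  fixes x :: real
  assumes "0 \<le> x" "x < 1"
  shows "(\<Sum>i<n. (real i + 2) * (real i + 1) * x ^ i) \<le> 2 / (1 - x) ^ 3"
proof -
  have "(1 - x) * (\<Sum>i<n. (real i + 2) * (real i + 1) * x ^ i)
      = 2 * (\<Sum>i<n. (real i + 1) * x ^ i) - real n * (real n + 1) * x ^ n"
  proof (induction n)
    case (Suc n)
    show ?case unfolding sum.lessThan_Suc distrib_left[of "1 - x"] Suc.IH by (simp add: algebra_simps)
  qed simp
  also have "\<dots> \<le> 2 * (1 / (1 - x)\<^sup>2)"
    using sum_Suc_power_le[OF assms, of n] assms by (smt (verit) mult_nonneg_nonneg of_nat_0_le_iff zero_le_power)
  finally have "(\<Sum>i<n. (real i + 2) * (real i + 1) * x ^ i) \<le> 2 * (1 / (1 - x)\<^sup>2) / (1 - x)"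
    using assms by (subst pos_le_divide_eq) (simp_all only: mult.commute[of "1 - x"] diff_gt_0_iff_gt)
  also have "\<dots> = 2 / (1 - x) ^ 3" by (simp add: power2_eq_square power3_eq_cube)
  finally show ?thesis .
qed

text \<open>Induction on the search depth follows the actual digits of the tail through the tree, so
  only the branch they select is used. Since \<open>b\<close> and \<open>N\<close> vary in the
  induction, one finite search covers polynomials of every degree.\<close>

lemma excl_sound:
  fixes b :: "nat \<Rightarrow> int"
  assumes "excl p q n u v S T P" "0 < p" "p < q" "0 < P" "\<And>i. b i \<in> {-1, 0, 1}"
    "\<bar>of_int u + of_int P * (\<Sum>i<N. of_int (b i) * (of_int p / of_int q) ^ i)\<bar> \<le> (of_int S :: real)"
  shows "\<bar>of_int v + of_int P * (\<Sum>i<N. real i * of_int (b i) * (of_int p / of_int q) ^ i)\<bar> > (of_int T :: real)"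
  using assms
proof (induction n arbitrary: u v S T P b N)
  case 0
  then show ?case by simp
next
  case (Suc n)
  define x where "x = (of_int p / of_int q :: real)"
  have x: "0 < x" "x < 1" using Suc.prems by (auto simp: x_def)
  have babs: "\<bar>real_of_int (b i)\<bar> \<le> 1" for i using Suc.prems(5)[of i] by auto
  have d: "of_int (q - p) = of_int q * (1 - x)" "of_int p = of_int q * x"
    using Suc.prems(2,3) by (auto simp: x_def field_simps)
  have qp: "0 < real_of_int q" using Suc.prems(2,3) by simp
  have "\<bar>\<Sum>i<N. of_int (b i) * x ^ i\<bar> \<le> (\<Sum>i<N. x ^ i)"
    by (rule order.trans[OF sum_abs sum_mono]) (use babs x in \<open>auto simp: abs_mult mult_left_le_one_le\<close>)
  also have "\<dots> \<le> 1 / (1 - x)" by (rule sum_power_le) (use x in auto)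
  finally have g0: "\<bar>\<Sum>i<N. of_int (b i) * x ^ i\<bar> \<le> 1 / (1 - x)" .
  have "\<bar>\<Sum>i<N. real i * of_int (b i) * x ^ i\<bar> \<le> (\<Sum>i<N. real i * x ^ i)"
    by (rule order.trans[OF sum_abs sum_mono])
      (use babs x in \<open>auto simp: abs_mult mult.assoc intro!: mult_left_mono mult_left_le_one_le\<close>)
  also have "\<dots> \<le> x * (1 / (1 - x)\<^sup>2)"
  proof (cases N)
    case (Suc M)
    have "(\<Sum>i<N. real i * x ^ i) = x * (\<Sum>i<M. (real i + 1) * x ^ i)"
      unfolding Suc sum.lessThan_Suc_shift by (simp add: sum_distrib_left algebra_simps)
    then show ?thesis
      unfolding \<open>(\<Sum>i<N. real i * x ^ i) = _\<close> using x
      by (intro mult_left_mono sum_Suc_power_le) auto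
  qed (use x in auto)
  finally have g1: "\<bar>\<Sum>i<N. real i * of_int (b i) * x ^ i\<bar> \<le> x / (1 - x)\<^sup>2" by simp
  let ?g = "\<Sum>i<N. of_int (b i) * x ^ i" and ?h = "\<Sum>i<N. real i * of_int (b i) * x ^ i"
  have le: "\<bar>of_int u + of_int P * ?g\<bar> \<le> of_int S" using Suc.prems(6) by (simp add: x_def)
  have P: "0 < real_of_int P" using Suc.prems(4) by simp
  consider (u) "q * P + (q - p) * S < (q - p) * \<bar>u\<bar>"
    | (v) "p * q * P + (q - p)\<^sup>2 * T < (q - p)\<^sup>2 * \<bar>v\<bar>"
    | (r) "excl p q n (q * (u - P)) (q * (v - u + P)) (q * S) (q * (T + S)) (p * P)"
      "excl p q n (q * u) (q * (v - u)) (q * S) (q * (T + S)) (p * P)"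
      "excl p q n (q * (u + P)) (q * (v - u - P)) (q * S) (q * (T + S)) (p * P)"
    using Suc.prems(1) by auto
  then have "\<bar>of_int v + of_int P * ?h\<bar> > of_int T"
  proof cases
    case u
    have "real_of_int (q * P + (q - p) * S) < of_int ((q - p) * \<bar>u\<bar>)" using u by linarith
    then have "of_int q * (of_int P + (1 - x) * of_int S) < of_int q * ((1 - x) * \<bar>real_of_int u\<bar>)"
      unfolding of_int_add of_int_mult d of_int_abs by (simp add: algebra_simps)
    then have "of_int P + (1 - x) * of_int S < (1 - x) * \<bar>real_of_int u\<bar>" using qp by simp
    moreover have "(1 - x) * \<bar>real_of_int P * ?g\<bar> \<le> of_int P"
      using mult_left_mono[OF g0, of "real_of_int P * (1 - x)"] P x by (simp add: abs_mult mult_ac)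
    moreover have "(1 - x) * \<bar>of_int u + of_int P * ?g\<bar> \<le> (1 - x) * of_int S"
      using le x by (intro mult_left_mono) auto
    moreover have "(1 - x) * \<bar>real_of_int u\<bar> \<le> (1 - x) * (\<bar>of_int u + of_int P * ?g\<bar> + \<bar>of_int P * ?g\<bar>)"
      using x by (intro mult_left_mono) auto
    ultimately show ?thesis by (simp add: distrib_left)
  next
    case v
    have "real_of_int (p * q * P + (q - p)\<^sup>2 * T) < of_int ((q - p)\<^sup>2 * \<bar>v\<bar>)" using v by linarith
    then have "(of_int q)\<^sup>2 * (x * of_int P + (1 - x)\<^sup>2 * of_int T) < (of_int q)\<^sup>2 * ((1 - x)\<^sup>2 * \<bar>real_of_int v\<bar>)"
      unfolding of_int_add of_int_mult of_int_power d of_int_abs by (simp add: algebra_simps power2_eq_square)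
    then have "x * of_int P + (1 - x)\<^sup>2 * of_int T < (1 - x)\<^sup>2 * \<bar>real_of_int v\<bar>" using qp by simp
    moreover have "(1 - x)\<^sup>2 * \<bar>real_of_int P * ?h\<bar> \<le> x * of_int P"
      using mult_left_mono[OF g1, of "real_of_int P * (1 - x)\<^sup>2"] P x by (simp add: abs_mult mult_ac)
    moreover have "(1 - x)\<^sup>2 * \<bar>real_of_int v\<bar> \<le> (1 - x)\<^sup>2 * (\<bar>of_int v + of_int P * ?h\<bar> + \<bar>of_int P * ?h\<bar>)"
      by (intro mult_left_mono) auto
    ultimately have "(1 - x)\<^sup>2 * of_int T < (1 - x)\<^sup>2 * \<bar>of_int v + of_int P * ?h\<bar>"
      by (simp add: distrib_left)
    then show ?thesis using x by simp
  next
    case r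
    \<comment> \<open>An empty tail is read as the digit \<open>0\<close> followed by an empty tail,
      so the branching also makes sense at \<open>N = 0\<close>.\<close>
    define a where "a = (if N = 0 then 0 else b 0)"
    define M where "M = N - 1"
    define c where "c i = b (Suc i)" for i
    have a: "a \<in> {-1, 0, 1}" using Suc.prems(5)[of 0] by (auto simp: a_def)
    have ex: "excl p q n (q * (u + a * P)) (q * (v - u - a * P)) (q * S) (q * (T + S)) (p * P)"
      using a r by auto
    define G where "G = (\<Sum>i<M. of_int (c i) * x ^ i)"
    define H where "H = (\<Sum>i<M. real i * of_int (c i) * x ^ i)"
    have g: "?g = of_int a + x * G" 
      by (cases N) (auto simp: a_def G_def c_def M_def sum.lessThan_Suc_shift sum_distrib_left algebra_simps simp del: sum.lessThan_Suc)
    have h: "?h = x * (G + H)"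
      by (cases N) (auto simp: G_def H_def c_def M_def sum.lessThan_Suc_shift sum_distrib_left algebra_simps sum.distrib simp del: sum.lessThan_Suc)
    have G: "of_int (q * (u + a * P)) + of_int (p * P) * G = of_int q * (of_int u + of_int P * ?g)"
      by (simp add: g d algebra_simps)
    \<comment> \<open>From \<open>g = a + x G\<close> follows \<open>\<theta>g = x (G + H)\<close>.
      Subtracting the constraint on \<open>g\<close> removes \<open>G\<close>, at the price of
      enlarging the tolerance \<open>T\<close> to \<open>T + S\<close>.\<close>
    have H: "of_int (q * (v - u - a * P)) + of_int (p * P) * H
       = of_int q * ((of_int v + of_int P * ?h) - (of_int u + of_int P * ?g))"
      unfolding g h by (simp add: d algebra_simps)
    have "\<bar>of_int (q * (v - u - a * P)) + of_int (p * P) * H\<bar> > of_int (q * (T + S))"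
      unfolding H_def x_def
    proof (rule Suc.IH[OF ex \<open>0 < p\<close> \<open>p < q\<close>])
      show "0 < p * P" using Suc.prems by simp
      show "c i \<in> {-1, 0, 1}" for i using Suc.prems(5) by (simp add: c_def)
      have "\<bar>of_int (q * (u + a * P)) + of_int (p * P) * G\<bar> \<le> of_int (q * S)"
        unfolding G using le qp by (simp add: abs_mult)
      then show "\<bar>of_int (q * (u + a * P)) + of_int (p * P) * (\<Sum>i<M. of_int (c i) * (of_int p / of_int q) ^ i)\<bar> \<le> real_of_int (q * S)"
        by (simp add: G_def x_def)
    qed
    then have "of_int q * of_int (T + S) < of_int q * \<bar>(of_int v + of_int P * ?h) - (of_int u + of_int P * ?g)\<bar>"
      unfolding H using qp by (simp add: abs_mult)
    then have "of_int (T + S) < \<bar>(of_int v + of_int P * ?h) - (of_int u + of_int P * ?g)\<bar>"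
      using qp by simp
    then show ?thesis using le by auto
  qed
  then show ?case by (simp add: x_def)
qed

text \<open>The initial state is the child for digit \<open>1\<close> of the state
  \<open>u = v = 0\<close>, \<open>P = K\<close>; the children for \<open>0\<close> and
  \<open>-1\<close> are left out because the constant term is \<open>1\<close>. The factor
  \<open>K\<close> lets integers \<open>S\<close> and \<open>T\<close> express the rational
  tolerances \<open>S / K\<close> and \<open>T / K\<close>.\<close>

lemma excl_root:
  fixes a :: "nat \<Rightarrow> int"
  assumes ex: "excl p q n (q * K) (- (q * K)) (q * S) (q * (T + S)) (p * K)"
    and pq: "0 < p" "p < q" "0 < K" and a: "\<And>i. a i \<in> {-1, 0, 1}" "a 0 = 1" and N: "0 < N"
    and le: "of_int K * \<bar>\<Sum>i<N. of_int (a i) * (of_int p / of_int q) ^ i\<bar> \<le> (of_int S :: real)"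
  shows "of_int K * \<bar>\<Sum>i<N. real i * of_int (a i) * (of_int p / of_int q) ^ i\<bar> > (of_int T :: real)"
proof -
  define x where "x = (of_int p / of_int q :: real)"
  have d: "of_int p = of_int q * x" using pq by (auto simp: x_def field_simps)
  have q: "0 < real_of_int q" using pq by simp
  define c where "c i = a (Suc i)" for i
  obtain M where M: "N = Suc M" using N by (cases N) auto
  define G where "G = (\<Sum>i<M. of_int (c i) * x ^ i)"
  define H where "H = (\<Sum>i<M. real i * of_int (c i) * x ^ i)"
  let ?f = "\<Sum>i<N. of_int (a i) * x ^ i" and ?h = "\<Sum>i<N. real i * of_int (a i) * x ^ i"
  have f: "?f = 1 + x * G"
    by (auto simp: G_def c_def M a sum.lessThan_Suc_shift sum_distrib_left algebra_simps simp del: sum.lessThan_Suc)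
  have h: "?h = x * (G + H)"
    by (auto simp: G_def H_def c_def M sum.lessThan_Suc_shift sum_distrib_left algebra_simps sum.distrib simp del: sum.lessThan_Suc)
  have le': "\<bar>of_int K * ?f\<bar> \<le> of_int S"
    using le pq by (simp add: x_def abs_mult)
  have G: "of_int (q * K) + of_int (p * K) * G = of_int q * (of_int K * ?f)"
    unfolding f by (simp add: d algebra_simps)
  have H: "of_int (- (q * K)) + of_int (p * K) * H = of_int q * (of_int K * ?h - of_int K * ?f)"
    unfolding f h by (simp add: d algebra_simps)
  have "\<bar>of_int (- (q * K)) + of_int (p * K) * H\<bar> > of_int (q * (T + S))"
    unfolding H_def x_def
  proof (rule excl_sound[OF ex])
    have "\<bar>of_int (q * K) + of_int (p * K) * G\<bar> \<le> of_int (q * S)"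
      unfolding G using le' q by (simp add: abs_mult)
    then show "\<bar>of_int (q * K) + of_int (p * K) * (\<Sum>i<M. of_int (c i) * (of_int p / of_int q) ^ i)\<bar> \<le> real_of_int (q * S)"
      by (simp add: G_def x_def)
  qed (use pq a in \<open>auto simp: c_def\<close>)
  then have "of_int q * of_int (T + S) < of_int q * \<bar>of_int K * ?h - of_int K * ?f\<bar>"
    unfolding H using q by (simp add: abs_mult)
  then have "of_int (T + S) < \<bar>of_int K * ?h - of_int K * ?f\<bar>" using q by simp
  then have "of_int T < \<bar>of_int K * ?h\<bar>" using le' by auto
  then show ?thesis using pq by (simp add: x_def abs_mult)
qed

section \<open>From a rational centre to an interval around it\<close>

lemma has_derivative_poly_sum:
  fixes a :: "nat \<Rightarrow> real"
  shows "((\<lambda>x. \<Sum>i<N. a i * x ^ i) has_field_derivative (\<Sum>i<N. real i * a i * x ^ (i - 1))) (at x within A)"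
    and "((\<lambda>x. \<Sum>i<N. real i * a i * x ^ (i - 1)) has_field_derivative
      (\<Sum>i<N. real i * real (i - 1) * a i * x ^ (i - 2))) (at x within A)"
  by (auto intro!: derivative_eq_intros sum.cong simp: numeral_2_eq_2)

lemma abs_deriv_sum_le:
  fixes a :: "nat \<Rightarrow> real"
  assumes a: "\<And>i. \<bar>a i\<bar> \<le> 1" and x: "0 \<le> x" "x \<le> r" "r < 1"
  shows "\<bar>\<Sum>i<N. real i * a i * x ^ (i - 1)\<bar> \<le> 1 / (1 - r)\<^sup>2"
proof (cases N)
  case (Suc M)
  have le: "\<bar>a k\<bar> * x ^ i \<le> r ^ i" for k i
    using mult_mono[OF a power_mono[OF x(2,1)], of i k] x by simp
  have "\<bar>\<Sum>i<N. real i * a i * x ^ (i - 1)\<bar> = \<bar>\<Sum>i<M. (real i + 1) * a (Suc i) * x ^ i\<bar>"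
    unfolding Suc sum.lessThan_Suc_shift by (simp add: add.commute)
  also have "\<dots> \<le> (\<Sum>i<M. (real i + 1) * r ^ i)"
    using le x by (intro order.trans[OF sum_abs sum_mono])
      (auto simp: abs_mult mult.assoc intro!: mult_left_mono)
  also have "\<dots> \<le> 1 / (1 - r)\<^sup>2" by (rule sum_Suc_power_le) (use x in auto)
  finally show ?thesis .
qed simp

lemma abs_deriv2_sum_le:
  fixes a :: "nat \<Rightarrow> real"
  assumes a: "\<And>i. \<bar>a i\<bar> \<le> 1" and x: "0 \<le> x" "x \<le> r" "r < 1"
  shows "\<bar>\<Sum>i<N. real i * real (i - 1) * a i * x ^ (i - 2)\<bar> \<le> 2 / (1 - r) ^ 3"
proof (cases "N < 2")
  case True
  then have "N = 0 \<or> N = 1" by auto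
  then show ?thesis using x by auto
next
  case False
  then obtain M where M: "N = Suc (Suc M)" by (metis not_less_eq less_Suc_eq_0_disj numeral_2_eq_2 old.nat.exhaust)
  have le: "\<bar>a k\<bar> * x ^ i \<le> r ^ i" for k i
    using mult_mono[OF a power_mono[OF x(2,1)], of i k] x by simp
  have "\<bar>\<Sum>i<N. real i * real (i - 1) * a i * x ^ (i - 2)\<bar>
      = \<bar>\<Sum>i<M. (real i + 2) * (real i + 1) * a (Suc (Suc i)) * x ^ i\<bar>"
    unfolding M sum.lessThan_Suc_shift by (simp add: add.commute numeral_2_eq_2)
  also have "\<dots> \<le> (\<Sum>i<M. (real i + 2) * (real i + 1) * r ^ i)"
    using le x by (intro order.trans[OF sum_abs sum_mono])
      (auto simp: abs_mult mult.assoc intro!: mult_left_mono)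
  also have "\<dots> \<le> 2 / (1 - r) ^ 3" by (rule sum_Suc_Suc_power_le) (use x in auto)
  finally show ?thesis .
qed

text \<open>If \<open>f\<close> and \<open>f'\<close> were both below \<open>\<delta>\<close> at
  \<open>x\<close>, the mean value inequality, applied first to \<open>f'\<close> and then to
  \<open>f\<close>, would carry smallness over to the centre \<open>c\<close>. With
  \<open>M = 2 / (1 - (c + h)) ^ 3\<close> bounding \<open>f''\<close>, this gives
  \<open>\<delta> + h M\<close> for \<open>f'\<close> and
  \<open>\<delta> + h (\<delta> + h M)\<close> for \<open>f\<close>, which the search at
  \<open>c\<close> excludes.\<close>

lemma transversal_near:
  fixes a :: "nat \<Rightarrow> int"
  assumes ex: "excl p q n (q * K) (- (q * K)) (q * S) (q * (T + S)) (p * K)"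
    and pq: "0 < p" "p < q" "0 < K" and a: "\<And>i. a i \<in> {-1, 0, 1}" "a 0 = 1" and N: "0 < N"
    and c: "c = of_int p / of_int q" and h: "h \<le> c" "c + h < 1"
    and S: "of_int K * (\<delta> + h * (\<delta> + h * (2 / (1 - (c + h)) ^ 3))) \<le> of_int S"
    and T: "of_int K * (c * (\<delta> + h * (2 / (1 - (c + h)) ^ 3))) \<le> of_int T"
    and x: "\<bar>x - c\<bar> \<le> h"
  shows "\<bar>\<Sum>i<N. of_int (a i) * x ^ i\<bar> \<ge> \<delta> \<or> \<bar>\<Sum>i<N. real i * of_int (a i) * x ^ (i - 1)\<bar> \<ge> \<delta>"
proof (rule ccontr)
  let ?f = "\<lambda>x :: real. \<Sum>i<N. of_int (a i) * x ^ i"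
  let ?f' = "\<lambda>x :: real. \<Sum>i<N. real i * of_int (a i) * x ^ (i - 1)"
  define M where "M = 2 / (1 - (c + h)) ^ 3"
  assume "\<not> ?thesis"
  then have fx: "\<bar>?f x\<bar> < \<delta>" "\<bar>?f' x\<bar> < \<delta>" by auto
  have a1: "\<bar>real_of_int (a i)\<bar> \<le> 1" for i using a(1)[of i] by auto
  have h0: "0 \<le> h" using x by linarith
  have c0: "0 < c" using pq c by simp
  have M0: "0 \<le> M" using h by (simp add: M_def)
  let ?I = "{c - h..c + h}"
  have f'_lip: "\<bar>?f' y - ?f' x\<bar> \<le> M * \<bar>y - x\<bar>" if "y \<in> ?I" for y
    using field_differentiable_bound[OF _ has_derivative_poly_sum(2), of ?I "\<lambda>i. of_int (a i)" N M y x]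
      abs_deriv2_sum_le[of "\<lambda>i. of_int (a i)" _ "c + h" N] a1 h x that
    by (force simp: M_def)
  have "\<bar>?f' c - ?f' x\<bar> \<le> M * h"
    using f'_lip[of c] x h0 M0 by (auto intro: order.trans mult_left_mono simp: abs_minus_commute)
  then have f'c: "\<bar>?f' c\<bar> < \<delta> + h * M" using fx by (auto simp: mult.commute)
  have "\<bar>?f c - ?f x\<bar> \<le> (\<delta> + h * M) * \<bar>c - x\<bar>"
  proof (rule field_differentiable_bound[OF _ has_derivative_poly_sum(1), where S = "closed_segment c x", simplified real_norm_def])
    fix y assume y: "y \<in> closed_segment c x"
    then have y': "\<bar>y - x\<bar> \<le> h" "y \<in> ?I" using x by (auto simp: closed_segment_eq_real_ivl split: if_splits)
    then have "M * \<bar>y - x\<bar> \<le> M * h" using M0 by (intro mult_left_mono)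
    then show "\<bar>?f' y\<bar> \<le> \<delta> + h * M" using f'_lip[OF y'(2)] fx by (simp add: mult.commute)
  qed auto
  also have "\<dots> \<le> (\<delta> + h * M) * h"
    using x f'c by (intro mult_left_mono) (auto simp: abs_minus_commute)
  finally have fc: "\<bar>?f c\<bar> \<le> \<delta> + h * (\<delta> + h * M)" using fx by (auto simp: mult.commute)
  \<comment> \<open>The search bounds \<open>x f'\<close> rather than \<open>f'\<close>. The
    truncated exponent at \<open>i = 0\<close> is harmless, as that term has coefficient
    zero.\<close>
  have "(\<Sum>i<N. real i * of_int (a i) * c ^ i) = c * ?f' c"
    unfolding sum_distrib_left by (intro sum.cong refl) (auto simp: algebra_simps power_eq_if)
  moreover have "of_int K * \<bar>\<Sum>i<N. real i * of_int (a i) * c ^ i\<bar> > (of_int T :: real)"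
    unfolding c
  proof (rule excl_root[where a = a, OF ex pq a N])
    have "of_int K * \<bar>?f c\<bar> \<le> of_int K * (\<delta> + h * (\<delta> + h * M))"
      using fc pq by (intro mult_left_mono) auto
    then show "of_int K * \<bar>?f (of_int p / of_int q)\<bar> \<le> of_int S" using S by (simp add: M_def c)
  qed
  moreover have "of_int K * \<bar>c * ?f' c\<bar> \<le> of_int K * (c * (\<delta> + h * M))"
    using f'c pq c0 by (intro mult_left_mono) (auto simp: abs_mult)
  ultimately show False using T by (simp add: M_def)
qed

text \<open>Seven abutting intervals cover \<open>[1/2, 0.668]\<close>; on each, a search of depth
  at most 15 is evaluated at the centre. With \<open>K = 1000000\<close>, the numbers
  \<open>S\<close> and \<open>T\<close> are tolerances in millionths.\<close>

lemma transversality_pos: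
  fixes a :: "nat \<Rightarrow> int"
  assumes a: "\<And>i. a i \<in> {-1, 0, 1}" "a 0 = 1" and N: "0 < N" and x: "1 / 2 \<le> x" "x \<le> 0.668"
  shows "\<bar>\<Sum>i<N. of_int (a i) * x ^ i\<bar> \<ge> 1 / 10000 \<or>
    \<bar>\<Sum>i<N. real i * of_int (a i) * x ^ (i - 1)\<bar> \<ge> 1 / 10000"
proof -
  note near = transversal_near[where a = a and q = 10000 and K = 1000000 and n = 15, OF _ _ _ _ a(1) a(2) N refl]
  \<comment> \<open>centres and radii found greedily from the left, with the largest radius for which the search
    closes; \<open>S\<close> and \<open>T\<close> are the error bounds required by \<open>transversal_near\<close>, rounded up\<close>
  consider "\<bar>x - 0.5526\<bar> \<le> 0.0526" | "\<bar>x - 0.6214\<bar> \<le> 0.0162" | "\<bar>x - 0.6464\<bar> \<le> 0.0088"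
    | "\<bar>x - 0.6594\<bar> \<le> 0.0042" | "\<bar>x - 0.6650\<bar> \<le> 0.0014" | "\<bar>x - 0.6670\<bar> \<le> 0.0006"
    | "\<bar>x - 0.6678\<bar> \<le> 0.0002"
    using x by (auto simp: abs_le_iff) argo
  then show ?thesis
  proof cases
    case 1
    show ?thesis
      by (rule near[of 5526 90029 944759 "0.0526"], code_simp) (use 1 in \<open>simp_all add: field_simps\<close>)
  next
    case 2
    show ?thesis
      by (rule near[of 6214 11130 423074 "0.0162"], code_simp) (use 2 in \<open>simp_all add: field_simps\<close>)
  next
    case 3
    show ?thesis
      by (rule near[of 6464 3880 277597 "0.0088"], code_simp) (use 3 in \<open>simp_all add: field_simps\<close>)
  next
    case 4
    show ?thesis
      by (rule near[of 6594 1028 145566 "0.0042"], code_simp) (use 4 in \<open>simp_all add: field_simps\<close>)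
  next
    case 5
    show ?thesis
      by (rule near[of 6650 206 50221 "0.0014"], code_simp) (use 5 in \<open>simp_all add: field_simps\<close>)
  next
    case 6
    show ?thesis
      by (rule near[of 6670 120 21861 "0.0006"], code_simp) (use 6 in \<open>simp_all add: field_simps\<close>)
  next
    case 7
    show ?thesis
      by (rule near[of 6678 103 7367 "0.0002"], code_simp) (use 7 in \<open>simp_all add: field_simps\<close>)
  qed
qed

section \<open>Parameters with close points\<close>

text \<open>Bisect \<open>k\<close> times, until \<open>G\<close> varies by less than
  \<open>\<delta> / 2\<close> on each piece. A piece containing some \<open>z\<close> with
  \<open>\<bar>G z\<bar> \<le> \<rho>\<close> then has \<open>\<bar>G\<bar> < \<delta>\<close>
  throughout, hence \<open>\<bar>G'\<bar> \<ge> \<delta>\<close> throughout, and the mean value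
  theorem puts all small values within \<open>2 * \<rho> / \<delta>\<close> of
  \<open>z\<close>.\<close>

lemma emeasure_small_values_le:
  fixes G G' :: "real \<Rightarrow> real"
  assumes "a \<le> b" "\<And>y. y \<in> {a..b} \<Longrightarrow> (G has_field_derivative G' y) (at y)"
    "\<And>y. y \<in> {a..b} \<Longrightarrow> \<bar>G' y\<bar> \<le> L"
    "\<And>y. y \<in> {a..b} \<Longrightarrow> \<bar>G y\<bar> \<ge> \<delta> \<or> \<bar>G' y\<bar> \<ge> \<delta>"
    and \<delta>: "0 < \<delta>" "\<rho> < \<delta> / 2" "0 \<le> \<rho>" and "L * (b - a) < 2 ^ k * (\<delta> / 2)"
  shows "emeasure lborel {y \<in> {a..b}. \<bar>G y\<bar> \<le> \<rho>} \<le> ennreal (2 ^ k * (4 * \<rho> / \<delta>))"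
  using assms(1-4,8)
proof (induction k arbitrary: a b)
  case 0
  show ?case
  proof (cases "{y \<in> {a..b}. \<bar>G y\<bar> \<le> \<rho>} = {}")
    case True
    then show ?thesis by (simp only: emeasure_empty) simp
  next
    case False
    then obtain z where z: "z \<in> {a..b}" "\<bar>G z\<bar> \<le> \<rho>" by auto
    have L0: "0 \<le> L" using "0.prems"(3)[of a] "0.prems"(1) by force
    have big: "\<bar>G' y\<bar> \<ge> \<delta>" if y: "y \<in> {a..b}" for y
    proof -
      have "\<bar>G y - G z\<bar> \<le> L * \<bar>y - z\<bar>"
        using field_differentiable_bound[of "{a..b}" G G' L y z] "0.prems" y z
        by (auto intro: DERIV_subset)
      also have "\<dots> \<le> L * (b - a)" using y z L0 by (intro mult_left_mono) auto
      finally have "\<bar>G y\<bar> < \<delta>" using z \<delta> "0.prems"(5) by auto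
      then show ?thesis using "0.prems"(4)[OF y] by auto
    qed
    have "{y \<in> {a..b}. \<bar>G y\<bar> \<le> \<rho>} \<subseteq> {z - 2 * \<rho> / \<delta>..z + 2 * \<rho> / \<delta>}"
    proof safe
      fix y assume y: "y \<in> {a..b}" "\<bar>G y\<bar> \<le> \<rho>"
      have "\<bar>y - z\<bar> * \<delta> \<le> 2 * \<rho>"
      proof (cases "y = z")
        case False
        define s t where "s = min y z" and "t = max y z"
        have st: "s < t" "a \<le> s" "t \<le> b" using False y z by (auto simp: s_def t_def)
        obtain u where u: "s < u" "u < t" "G t - G s = (t - s) * G' u"
          using MVT2[OF st(1), of G G'] "0.prems"(2) st by auto
        have "\<bar>y - z\<bar> * \<delta> \<le> (t - s) * \<bar>G' u\<bar>"
          using big[of u] u st \<delta> by (intro mult_mono) (auto simp: s_def t_def max_def min_def)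
        also have "\<dots> = \<bar>G t - G s\<bar>" using u st by (simp add: abs_mult)
        also have "\<dots> \<le> 2 * \<rho>" using y z by (auto simp: s_def t_def min_def max_def)
        finally show ?thesis .
      qed (use \<delta> in auto)
      then have "\<bar>y - z\<bar> \<le> 2 * \<rho> / \<delta>" using \<delta> by (simp add: field_simps)
      then show "y \<in> {z - 2 * \<rho> / \<delta>..z + 2 * \<rho> / \<delta>}" by (auto simp: abs_le_iff)
    qed
    then have "emeasure lborel {y \<in> {a..b}. \<bar>G y\<bar> \<le> \<rho>} \<le> emeasure lborel {z - 2 * \<rho> / \<delta>..z + 2 * \<rho> / \<delta>}"
      by (intro emeasure_mono) auto
    also have "\<dots> = ennreal (4 * \<rho> / \<delta>)" using \<delta> by (subst emeasure_lborel_Icc) (auto simp: field_simps)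
    finally show ?thesis by simp
  qed
next
  case (Suc k)
  define c where "c = (a + b) / 2"
  have c: "a \<le> c" "c \<le> b" "c - a = (b - a) / 2" "b - c = (b - a) / 2"
    using Suc.prems(1) by (auto simp: c_def field_simps)
  have cont: "continuous_on {a..b} G"
    using Suc.prems(2) by (intro DERIV_atLeastAtMost_imp_continuous_on) auto
  have meas: "{y \<in> {s..t}. \<bar>G y\<bar> \<le> \<rho>} \<in> sets lborel" if "a \<le> s" "t \<le> b" for s t
  proof -
    have "continuous_on {s..t} G" using cont by (rule continuous_on_subset) (use that in auto)
    then have "closed ({s..t} \<inter> G -` {-\<rho>..\<rho>})" by (intro continuous_closed_preimage) auto
    moreover have "{s..t} \<inter> G -` {-\<rho>..\<rho>} = {y \<in> {s..t}. \<bar>G y\<bar> \<le> \<rho>}" by auto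
    ultimately show ?thesis by (simp add: borel_closed)
  qed
  have "emeasure lborel {y \<in> {a..b}. \<bar>G y\<bar> \<le> \<rho>}
      \<le> emeasure lborel ({y \<in> {a..c}. \<bar>G y\<bar> \<le> \<rho>} \<union> {y \<in> {c..b}. \<bar>G y\<bar> \<le> \<rho>})"
    using c by (intro emeasure_mono sets.Un meas) auto
  also have "\<dots> \<le> emeasure lborel {y \<in> {a..c}. \<bar>G y\<bar> \<le> \<rho>} + emeasure lborel {y \<in> {c..b}. \<bar>G y\<bar> \<le> \<rho>}"
    using c by (intro emeasure_subadditive meas) auto
  also have "\<dots> \<le> ennreal (2 ^ k * (4 * \<rho> / \<delta>)) + ennreal (2 ^ k * (4 * \<rho> / \<delta>))"
    using Suc.prems c by (intro add_mono Suc.IH) (auto simp: field_simps)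
  also have "\<dots> = ennreal (2 ^ Suc k * (4 * \<rho> / \<delta>))"
    using \<delta> by (subst ennreal_plus[symmetric]) auto
  finally show ?case .
qed

lemma transversality:
  fixes a :: "nat \<Rightarrow> int"
  assumes a: "\<And>i. a i \<in> {-1, 0, 1}" "a 0 \<noteq> 0" and N: "0 < N" and x: "1 / 2 \<le> x" "x \<le> 0.668"
  shows "\<bar>\<Sum>i<N. of_int (a i) * x ^ i\<bar> \<ge> 1 / 10000 \<or>
    \<bar>\<Sum>i<N. real i * of_int (a i) * x ^ (i - 1)\<bar> \<ge> 1 / 10000"
proof (cases "a 0 = 1")
  case True
  then show ?thesis using transversality_pos[of a N x] assms by blast
next
  case False
  then have "- a 0 = 1" using a(1)[of 0] a(2) by auto
  moreover have "- a i \<in> {-1, 0, 1}" for i using a(1)[of i] by auto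
  ultimately show ?thesis using transversality_pos[of "\<lambda>i. - a i" N x] N x by (simp add: sum_negf)
qed

text \<open>\<open>2 ^ 20\<close> subintervals, each contributing \<open>4 / \<delta>\<close> with \<open>\<delta> = 1 / 40000\<close>.\<close>

definition small_const :: real where "small_const = 2 ^ 20 * 160000"

lemma emeasure_poly_small_le:
  fixes a :: "nat \<Rightarrow> int"
  assumes a: "\<And>i. a i \<in> {-1, 0, 1}" "a 0 \<noteq> 0" and N: "0 < N" and \<rho>: "0 \<le> \<rho>"
  shows "emeasure lborel {\<beta> \<in> {beta_BS..2}. \<bar>\<Sum>i<N. of_int (a i) * (1 / \<beta>) ^ i\<bar> \<le> \<rho>} \<le> ennreal (small_const * \<rho>)"
proof (cases "\<rho> < 1 / 40000 / 2")
  case True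
  let ?f = "\<lambda>x :: real. \<Sum>i<N. of_int (a i) * x ^ i"
  let ?f' = "\<lambda>x :: real. \<Sum>i<N. real i * of_int (a i) * x ^ (i - 1)"
  have a1: "\<bar>real_of_int (a i)\<bar> \<le> 1" for i using a(1)[of i] by auto
  have "emeasure lborel {\<beta> \<in> {beta_BS..2}. \<bar>?f (1 / \<beta>)\<bar> \<le> \<rho>} \<le> ennreal (2 ^ 20 * (4 * \<rho> / (1 / 40000)))"
  \<comment> \<open>The chain rule for \<open>1 / y\<close> brings in \<open>1 / y ^ 2\<close>,
    which lies in \<open>[1/4, 1]\<close>: this turns \<open>1 / 10000\<close> into
    \<open>\<delta> = 1 / 40000\<close>. The Lipschitz bound is
    \<open>1 / 0.332 ^ 2 \<le> 10\<close>, and twenty bisections suffice because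
    \<open>10 * (2 - beta_BS) < 2 ^ 20 / 80000\<close>.\<close>
  proof (rule emeasure_small_values_le[where G' = "\<lambda>y. ?f' (1 / y) * (- 1 / y\<^sup>2)" and L = 10])
    fix y assume y: "y \<in> {beta_BS..2}"
    then have y1: "1 < y" "y \<le> 2" using beta_BS_bounds by auto
    have x: "1 / 2 \<le> 1 / y" "1 / y \<le> 0.668" using y y1 by (auto simp: beta_BS_def field_simps)
    have "((\<lambda>y. 1 / y) has_field_derivative (- 1 / y\<^sup>2)) (at y)"
      using y1 by (auto intro!: derivative_eq_intros simp: power2_eq_square)
    then show "((\<lambda>y. ?f (1 / y)) has_field_derivative ?f' (1 / y) * (- 1 / y\<^sup>2)) (at y)"
      by (rule DERIV_chain2[OF has_derivative_poly_sum(1)])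
    have y2: "1 / 4 \<le> 1 / y\<^sup>2" "1 / y\<^sup>2 \<le> 1"
      using y1 power_mono[of y 2 2] power_mono[of 1 y 2] by (auto simp: field_simps)
    have abs_eq: "\<bar>?f' (1 / y) * (- 1 / y\<^sup>2)\<bar> = \<bar>?f' (1 / y)\<bar> * (1 / y\<^sup>2)" by (simp add: abs_mult)
    have "\<bar>?f' (1 / y)\<bar> \<le> 1 / (1 - 0.668)\<^sup>2"
      by (rule abs_deriv_sum_le[OF a1 _ x(2)]) (use x(1) in linarith, simp)
    also have "\<dots> \<le> (10 :: real)" by (simp add: field_simps power2_eq_square)
    finally have "\<bar>?f' (1 / y)\<bar> * (1 / y\<^sup>2) \<le> 10 * 1" using y2 by (intro mult_mono) auto
    then show "\<bar>?f' (1 / y) * (- 1 / y\<^sup>2)\<bar> \<le> 10" unfolding abs_eq by simp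
    have "\<bar>?f' (1 / y)\<bar> * (1 / y\<^sup>2) \<ge> (1 / 10000) * (1 / 4)" if "\<bar>?f' (1 / y)\<bar> \<ge> 1 / 10000"
      using that y2 by (intro mult_mono) auto
    then show "\<bar>?f (1 / y)\<bar> \<ge> 1 / 40000 \<or> \<bar>?f' (1 / y) * (- 1 / y\<^sup>2)\<bar> \<ge> 1 / 40000"
      unfolding abs_eq using transversality[where a = a, OF a N x] by fastforce
  qed (use \<rho> True in \<open>auto simp: beta_BS_def field_simps\<close>)
  then show ?thesis by (simp add: small_const_def mult_ac)
next
  \<comment> \<open>For \<open>\<rho> \<ge> 1 / 80000\<close> the right-hand side is at least
    \<open>2 ^ 21\<close>, more than the length of the whole parameter interval.\<close>
  case False
  have "emeasure lborel {\<beta> \<in> {beta_BS..2}. \<bar>\<Sum>i<N. of_int (a i) * (1 / \<beta>) ^ i\<bar> \<le> \<rho>} \<le> emeasure lborel {beta_BS..2}"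
    by (intro emeasure_mono) auto
  also have "\<dots> = ennreal (2 - beta_BS)" by (subst emeasure_lborel_Icc) (auto simp: beta_BS_def)
  also have "\<dots> \<le> ennreal (small_const * \<rho>)"
    using False by (intro ennreal_leI) (auto simp: small_const_def beta_BS_def)
  finally show ?thesis .
qed

section \<open>Words, their points, and pairs of close points\<close>

definition words :: "nat \<Rightarrow> int list set" where
  "words n = {xs. set xs \<subseteq> {0, 1} \<and> length xs = n}"

lemma finite_words [simp]: "finite (words n)"
  unfolding words_def by (rule finite_lists_length_eq) simp

lemma card_words [simp]: "card (words n) = 2 ^ n"
  unfolding words_def by (subst card_lists_length_eq) (auto simp: numeral_2_eq_2)

lemma words_0 [simp]: "words 0 = {[]}"
  by (auto simp: words_def)

lemma words_Suc: "words (Suc n) = (\<lambda>(a, xs). a # xs) ` ({0, 1} \<times> words n)"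
  by (auto simp: words_def image_iff length_Suc_conv)

text \<open>The Horner form of the digit sum in \<open>V\<close>, without the factor
  \<open>\<beta> - 1\<close>. Lists allow recursion on the first digit, which both the pair estimate
  and the digit maps use.\<close>

primrec pt :: "real \<Rightarrow> int list \<Rightarrow> real" where
  "pt \<beta> [] = 0"
| "pt \<beta> (a # xs) = (of_int a + pt \<beta> xs) / \<beta>"

lemma measurable_pt [measurable]: "(\<lambda>\<beta>. pt \<beta> xs) \<in> borel_measurable borel"
  by (induction xs) auto

lemma sets_close_pair [measurable]: "{\<beta> \<in> {s..t}. (\<beta> - 1) * \<bar>pt \<beta> xs - pt \<beta> ys\<bar> \<le> \<rho>} \<in> sets borel"
  by measurable

text \<open>One factor \<open>1 / \<beta>\<close> is split off so that the first digit becomes the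
  constant term, as transversality requires.\<close>

lemma pt_eq_sum: "pt \<beta> xs = (\<Sum>i<length xs. of_int (xs ! i) * (1 / \<beta>) ^ i) / \<beta>"
proof (induction xs)
  case (Cons a xs)
  show ?case
    by (simp add: Cons sum.lessThan_Suc_shift sum_divide_distrib del: sum.lessThan_Suc)
qed simp

lemma pt_bounds:
  assumes "1 < \<beta>" "set xs \<subseteq> {0, 1}"
  shows "0 \<le> (\<beta> - 1) * pt \<beta> xs" "(\<beta> - 1) * pt \<beta> xs \<le> 1"
proof -
  have "0 \<le> pt \<beta> xs \<and> (\<beta> - 1) * pt \<beta> xs \<le> 1"
    using assms(2)
  proof (induction xs)
    case (Cons a xs)
    then have a: "a = 0 \<or> a = 1" and IH: "0 \<le> pt \<beta> xs" "(\<beta> - 1) * pt \<beta> xs \<le> 1" by auto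
    then have "(\<beta> - 1) * (of_int a + pt \<beta> xs) \<le> (\<beta> - 1) * 1 + 1"
      using assms(1) by (auto simp: algebra_simps)
    then show ?case using a IH assms(1) by (auto simp: field_simps)
  qed simp
  then show "0 \<le> (\<beta> - 1) * pt \<beta> xs" "(\<beta> - 1) * pt \<beta> xs \<le> 1" using assms(1) by auto
qed

text \<open>\<open>pair_weight b xs ys = b ^ k\<close> if \<open>xs\<close> and \<open>ys\<close> first differ at place \<open>k\<close>, counted from \<open>1\<close>.\<close>

fun pair_weight :: "real \<Rightarrow> int list \<Rightarrow> int list \<Rightarrow> real" where
  "pair_weight b (x # xs) (y # ys) = b * (if x = y then pair_weight b xs ys else 1)"
| "pair_weight b _ _ = 0"

lemma pair_weight_nonneg: "0 \<le> b \<Longrightarrow> 0 \<le> pair_weight b xs ys"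
  by (induction b xs ys rule: pair_weight.induct) auto

text \<open>Of the four choices of first digits two agree, giving \<open>2 * b\<close> times the
  previous sum, and two differ, giving \<open>2 * b * 4 ^ n\<close>. After division by
  \<open>4 ^ n\<close> the recursion has the fixed point \<open>b / (2 - b)\<close>. Pairs of equal
  words have weight zero.\<close>

lemma sum_pair_weight_le:
  assumes "0 \<le> b" "b < 2"
  shows "(\<Sum>xs\<in>words n. \<Sum>ys\<in>words n. pair_weight b xs ys) \<le> 4 ^ n * (b / (2 - b))"
proof (induction n)
  case 0
  then show ?case using assms by simp
next
  case (Suc n)
  have split: "(\<Sum>xs\<in>words (Suc n). f xs) = (\<Sum>xs\<in>words n. f (0 # xs) + f (1 # xs))" for f :: "int list \<Rightarrow> real"
  proof -
    have "inj_on (\<lambda>(a, xs). a # xs) ({0, 1 :: int} \<times> words n)" by (auto simp: inj_on_def)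
    then show ?thesis
      unfolding words_Suc
      by (simp add: sum.reindex case_prod_unfold sum.cartesian_product[symmetric, of "\<lambda>a xs. f (a # xs)", unfolded case_prod_unfold] sum.distrib)
  qed
  have "(\<Sum>xs\<in>words (Suc n). \<Sum>ys\<in>words (Suc n). pair_weight b xs ys)
    = 2 * b * (\<Sum>xs\<in>words n. \<Sum>ys\<in>words n. pair_weight b xs ys) + 2 * b * 4 ^ n"
    unfolding split
    by (simp add: sum.distrib sum_distrib_left[symmetric] power_mult_distrib[symmetric] algebra_simps)
  also have "\<dots> \<le> 2 * b * (4 ^ n * (b / (2 - b))) + 2 * b * 4 ^ n"
    using Suc assms by (intro add_mono mult_left_mono) auto
  also have "\<dots> = 4 ^ Suc n * (b / (2 - b))" using assms by (simp add: field_simps)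
  finally show ?case .
qed

text \<open>Removing a common first digit multiplies the difference by
  \<open>\<beta> \<le> b\<close>, so the induction passes from \<open>\<rho>\<close> to
  \<open>b * \<rho>\<close> and collects the powers in \<open>pair_weight\<close>. Once the first
  digits differ, the difference is a polynomial in \<open>1 / \<beta>\<close> with nonzero constant
  term and \<open>emeasure_poly_small_le\<close> applies.\<close>

lemma emeasure_close_pair_le:
  assumes b: "beta_BS \<le> b" "b \<le> 2"
  shows "\<lbrakk>xs \<in> words n; ys \<in> words n; xs \<noteq> ys; 0 \<le> \<rho>\<rbrakk> \<Longrightarrow>
    emeasure lborel {\<beta> \<in> {beta_BS..b}. (\<beta> - 1) * \<bar>pt \<beta> xs - pt \<beta> ys\<bar> \<le> \<rho>}
    \<le> ennreal (3 * small_const * \<rho> * pair_weight b xs ys)"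
proof (induction n arbitrary: xs ys \<rho>)
  case 0
  then show ?case by simp
next
  case (Suc n)
  obtain x xs' y ys' where xy: "xs = x # xs'" "ys = y # ys'" "xs' \<in> words n" "ys' \<in> words n"
    using Suc.prems(1,2) by (auto simp: words_Suc)
  have pos: "1.497 < \<beta>" if "beta_BS \<le> \<beta>" for \<beta> using that beta_BS_bounds by auto
  have b0: "0 < b" using b pos[of b] by auto
  show ?case
  proof (cases "x = y")
    case True
    have "(\<beta> - 1) * \<bar>pt \<beta> xs - pt \<beta> ys\<bar> \<le> \<rho> \<Longrightarrow> (\<beta> - 1) * \<bar>pt \<beta> xs' - pt \<beta> ys'\<bar> \<le> b * \<rho>"
      if "\<beta> \<in> {beta_BS..b}" for \<beta>
    proof -
      assume le: "(\<beta> - 1) * \<bar>pt \<beta> xs - pt \<beta> ys\<bar> \<le> \<rho>"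
      have \<beta>: "0 < \<beta>" "\<beta> \<le> b" using pos[of \<beta>] that by auto
      have "pt \<beta> xs - pt \<beta> ys = (pt \<beta> xs' - pt \<beta> ys') / \<beta>"
        unfolding xy True by (simp add: diff_divide_distrib[symmetric])
      then have "(\<beta> - 1) * \<bar>pt \<beta> xs' - pt \<beta> ys'\<bar> = \<beta> * ((\<beta> - 1) * \<bar>pt \<beta> xs - pt \<beta> ys\<bar>)"
        using \<beta> by (simp add: abs_divide)
      also have "\<dots> \<le> \<beta> * \<rho>"
        using le \<beta> by (intro mult_left_mono) auto
      finally have "(\<beta> - 1) * \<bar>pt \<beta> xs' - pt \<beta> ys'\<bar> \<le> \<beta> * \<rho>" .
      also have "\<dots> \<le> b * \<rho>" using \<beta> Suc.prems by (intro mult_right_mono) auto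
      finally show ?thesis .
    qed
    then have "emeasure lborel {\<beta> \<in> {beta_BS..b}. (\<beta> - 1) * \<bar>pt \<beta> xs - pt \<beta> ys\<bar> \<le> \<rho>}
        \<le> emeasure lborel {\<beta> \<in> {beta_BS..b}. (\<beta> - 1) * \<bar>pt \<beta> xs' - pt \<beta> ys'\<bar> \<le> b * \<rho>}"
      using sets_close_pair by (intro emeasure_mono) auto
    also have "\<dots> \<le> ennreal (3 * small_const * (b * \<rho>) * pair_weight b xs' ys')"
      using Suc.prems xy True b0 by (intro Suc.IH) auto
    finally show ?thesis using True by (simp add: xy mult_ac)
  next
    case False
    \<comment> \<open>Zero past the end of the words, since the transversality lemmas require every
      \<open>d i\<close> to be a digit.\<close>
    define d where "d i = (if i < Suc n then xs ! i - ys ! i else 0)" for i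
    have len: "length xs = Suc n" "length ys = Suc n" using Suc.prems by (auto simp: words_def)
    have d: "d i \<in> {-1, 0, 1}" for i
    proof (cases "i < Suc n")
      case True
      then have "xs ! i \<in> {0, 1}" "ys ! i \<in> {0, 1}"
        using Suc.prems len by (auto simp: words_def subset_iff)
      then show ?thesis using True by (auto simp: d_def)
    qed (simp add: d_def)
    have d0: "d 0 \<noteq> 0" using False by (simp add: d_def xy)
    have "\<bar>\<Sum>i<Suc n. of_int (d i) * (1 / \<beta>) ^ i\<bar> \<le> 3 * b * \<rho>"
      if \<beta>: "\<beta> \<in> {beta_BS..b}" and le: "(\<beta> - 1) * \<bar>pt \<beta> xs - pt \<beta> ys\<bar> \<le> \<rho>" for \<beta>
    proof -
      have \<beta>': "1.497 < \<beta>" "\<beta> \<le> b" using pos[of \<beta>] \<beta> by auto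
      have "pt \<beta> xs - pt \<beta> ys = (\<Sum>i<Suc n. of_int (d i) * (1 / \<beta>) ^ i) / \<beta>"
        unfolding pt_eq_sum len diff_divide_distrib[symmetric] sum_subtractf[symmetric]
        by (simp add: d_def algebra_simps)
      then have "(\<beta> - 1) * \<bar>\<Sum>i<Suc n. of_int (d i) * (1 / \<beta>) ^ i\<bar> = \<beta> * ((\<beta> - 1) * \<bar>pt \<beta> xs - pt \<beta> ys\<bar>)"
        using \<beta>' by (simp add: abs_divide del: sum.lessThan_Suc)
      also have "\<dots> \<le> \<beta> * \<rho>"
        using le \<beta>' by (intro mult_left_mono) auto
      also have "\<dots> \<le> b * \<rho>" using \<beta>' Suc.prems by (intro mult_right_mono) auto
      finally have "(\<beta> - 1) * \<bar>\<Sum>i<Suc n. of_int (d i) * (1 / \<beta>) ^ i\<bar> \<le> b * \<rho>" .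
      \<comment> \<open>Here \<open>1 / 3 < 0.497 < \<beta> - 1\<close>; this is the source of the
        factor \<open>3\<close>.\<close>
      moreover have "(1 / 3) * \<bar>\<Sum>i<Suc n. of_int (d i) * (1 / \<beta>) ^ i\<bar> \<le> (\<beta> - 1) * \<bar>\<Sum>i<Suc n. of_int (d i) * (1 / \<beta>) ^ i\<bar>"
        using \<beta>' by (intro mult_right_mono) auto
      ultimately show ?thesis by linarith
    qed
    then have "emeasure lborel {\<beta> \<in> {beta_BS..b}. (\<beta> - 1) * \<bar>pt \<beta> xs - pt \<beta> ys\<bar> \<le> \<rho>}
        \<le> emeasure lborel {\<beta> \<in> {beta_BS..2}. \<bar>\<Sum>i<Suc n. of_int (d i) * (1 / \<beta>) ^ i\<bar> \<le> 3 * b * \<rho>}"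
      using b by (intro emeasure_mono) (auto simp del: sum.lessThan_Suc)
    also have "\<dots> \<le> ennreal (small_const * (3 * b * \<rho>))"
      by (rule emeasure_poly_small_le) (use d d0 b0 Suc.prems in auto)
    finally show ?thesis using False by (simp add: xy mult_ac)
  qed
qed

section \<open>Limsup sets of positive measure\<close>

definition close_pairs :: "real \<Rightarrow> nat \<Rightarrow> real \<Rightarrow> (int list \<times> int list) set" where
  "close_pairs s n \<beta> = {(xs, ys) \<in> words n \<times> words n. xs \<noteq> ys \<and> (\<beta> - 1) * \<bar>pt \<beta> xs - pt \<beta> ys\<bar> \<le> s / 2 ^ n}"

definition crowded :: "real \<Rightarrow> real \<Rightarrow> nat \<Rightarrow> real set" where
  "crowded b s n = {\<beta> \<in> {beta_BS..b}. 2 ^ n / 2 \<le> real (card (close_pairs s n \<beta>))}"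

lemma finite_close_pairs [simp]: "finite (close_pairs s n \<beta>)"
  by (rule finite_subset[of _ "words n \<times> words n"]) (auto simp: close_pairs_def)

text \<open>Markov's inequality for the number of close pairs as a function of
  \<open>\<beta>\<close>. Its integral is the sum of the pair measures, at most
  \<open>3 * small_const * (s / 2 ^ n) * 4 ^ n * (b / (2 - b))\<close>; division by
  \<open>2 ^ n / 2\<close> leaves a bound free of \<open>n\<close>.\<close>

lemma emeasure_crowded_le:
  assumes b: "beta_BS \<le> b" "b < 2" and s: "0 \<le> s"
  shows "crowded b s n \<in> sets lborel"
    and "emeasure lborel (crowded b s n) \<le> ennreal (6 * small_const * (b / (2 - b)) * s)"
proof -
  define D where "D = {(xs, ys) \<in> words n \<times> words n. xs \<noteq> ys}"
  define A where "A p = {\<beta> \<in> {beta_BS..b}. (\<beta> - 1) * \<bar>pt \<beta> (fst p) - pt \<beta> (snd p)\<bar> \<le> s / 2 ^ n}" for p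
  have A [measurable]: "A p \<in> sets borel" for p unfolding A_def by (rule sets_close_pair)
  have finD [simp]: "finite D"
    by (rule finite_subset[of _ "words n \<times> words n"]) (auto simp: D_def)
  have b0: "0 \<le> b" using b beta_BS_bounds by auto
  have card: "real (card (close_pairs s n \<beta>)) = (\<Sum>p\<in>D. indicator (A p) \<beta>)" if "\<beta> \<in> {beta_BS..b}" for \<beta>
  proof -
    have "close_pairs s n \<beta> = {p \<in> D. \<beta> \<in> A p}"
      using that by (auto simp: close_pairs_def D_def A_def)
    then show ?thesis by (simp add: indicator_def sum.If_cases Int_def)
  qed
  have eq: "crowded b s n = {\<beta> \<in> {beta_BS..b}. 2 ^ n / 2 \<le> (\<Sum>p\<in>D. indicator (A p) \<beta> :: real)}"
    unfolding crowded_def using card by auto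
  show meas [measurable]: "crowded b s n \<in> sets lborel" unfolding eq by measurable
  have "ennreal (2 ^ n / 2) * emeasure lborel (crowded b s n) = (\<integral>\<^sup>+\<beta>. ennreal (2 ^ n / 2) * indicator (crowded b s n) \<beta> \<partial>lborel)"
    using meas by (subst nn_integral_cmult_indicator) auto
  also have "\<dots> \<le> (\<integral>\<^sup>+\<beta>. (\<Sum>p\<in>D. indicator (A p) \<beta>) \<partial>lborel)"
  proof (intro nn_integral_mono)
    fix \<beta> :: real
    have "ennreal (\<Sum>p\<in>D. indicator (A p) \<beta>) = (\<Sum>p\<in>D. indicator (A p) \<beta>)"
      by (simp add: indicator_def sum.If_cases ennreal_of_nat_eq_real_of_nat)
    then show "ennreal (2 ^ n / 2) * indicator (crowded b s n) \<beta> \<le> (\<Sum>p\<in>D. indicator (A p) \<beta>)"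
      by (auto simp: eq indicator_def[of "Collect _"] simp flip: \<open>ennreal _ = _\<close> intro!: ennreal_leI)
  qed
  also have "\<dots> = (\<Sum>p\<in>D. emeasure lborel (A p))" by (subst nn_integral_sum) auto
  also have "\<dots> \<le> (\<Sum>p\<in>D. ennreal (3 * small_const * (s / 2 ^ n) * pair_weight b (fst p) (snd p)))"
    unfolding A_def using b s by (intro sum_mono emeasure_close_pair_le) (auto simp: D_def)
  also have "\<dots> = ennreal (\<Sum>p\<in>D. 3 * small_const * (s / 2 ^ n) * pair_weight b (fst p) (snd p))"
    using s b0 by (intro sum_ennreal mult_nonneg_nonneg pair_weight_nonneg) (auto simp: small_const_def)
  also have "\<dots> \<le> ennreal (2 ^ n / 2 * (6 * small_const * (b / (2 - b)) * s))"
  proof (rule ennreal_leI)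
    have "(\<Sum>p\<in>D. pair_weight b (fst p) (snd p)) \<le> (\<Sum>p\<in>words n \<times> words n. pair_weight b (fst p) (snd p))"
      by (intro sum_mono2) (auto simp: D_def pair_weight_nonneg b0)
    also have "\<dots> = (\<Sum>xs\<in>words n. \<Sum>ys\<in>words n. pair_weight b xs ys)"
      by (simp add: sum.cartesian_product case_prod_unfold)
    also have "\<dots> \<le> 4 ^ n * (b / (2 - b))" using sum_pair_weight_le[OF b0 b(2)] .
    finally have "3 * small_const * (s / 2 ^ n) * (\<Sum>p\<in>D. pair_weight b (fst p) (snd p))
        \<le> 3 * small_const * (s / 2 ^ n) * (4 ^ n * (b / (2 - b)))"
      using s by (intro mult_left_mono) (auto simp: small_const_def)
    also have "\<dots> = 2 ^ n / 2 * (6 * small_const * (b / (2 - b)) * s)"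
    proof -
      have "(4 :: real) ^ n = 2 ^ n * 2 ^ n" by (simp add: power_mult_distrib[symmetric])
      then show ?thesis by simp
    qed
    finally show "(\<Sum>p\<in>D. 3 * small_const * (s / 2 ^ n) * pair_weight b (fst p) (snd p))
        \<le> 2 ^ n / 2 * (6 * small_const * (b / (2 - b)) * s)"
      by (simp only: sum_distrib_left)
  qed
  also have "\<dots> = ennreal (2 ^ n / 2) * ennreal (6 * small_const * (b / (2 - b)) * s)"
    by (rule ennreal_mult') simp
  finally show "emeasure lborel (crowded b s n) \<le> ennreal (6 * small_const * (b / (2 - b)) * s)"
    by (subst (asm) ennreal_mult_le_mult_iff) auto
qed

text \<open>It is enough to try \<open>s j = 1 / (j + 1)\<close>. The parameters crowded at all
  large \<open>n\<close> form an increasing union \<open>E j\<close> of sets of measure at most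
  \<open>K * s j\<close>, so \<open>E j\<close> obeys the same bound. A bad parameter lies in every
  \<open>E j\<close>, and \<open>K * s j\<close> tends to \<open>0\<close>.\<close>

lemma AE_not_crowded:
  assumes b: "beta_BS \<le> b" "b < 2"
  shows "AE \<beta> in lborel. \<beta> \<in> {beta_BS..b} \<longrightarrow> (\<exists>s>0. \<forall>m. \<exists>n\<ge>m. \<beta> \<notin> crowded b s n)"
proof -
  define K where "K = 6 * small_const * (b / (2 - b))"
  define s where "s j = 1 / (real j + 1)" for j
  define E where "E j = (\<Union>m. \<Inter>n\<in>{m..}. crowded b (s j) n)" for j
  have s: "0 < s j" for j by (simp add: s_def)
  have s_lim: "s \<longlonglongrightarrow> 0"
    unfolding s_def using LIMSEQ_inverse_real_of_nat by (simp add: inverse_eq_divide add.commute)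
  have meas [measurable]: "crowded b (s j) n \<in> sets borel" for j n
    using emeasure_crowded_le(1)[OF b] s[of j] by auto
  have le: "emeasure lborel (crowded b (s j) n) \<le> ennreal (K * s j)" for j n
    using emeasure_crowded_le(2)[OF b] s[of j] by (auto simp: K_def)
  have E_meas [measurable]: "E j \<in> sets borel" for j unfolding E_def by measurable
  have E_le: "emeasure lborel (E j) \<le> ennreal (K * s j)" for j
  proof -
    have "emeasure lborel (E j) = (SUP m. emeasure lborel (\<Inter>n\<in>{m..}. crowded b (s j) n))"
      unfolding E_def
    proof (intro SUP_emeasure_incseq[symmetric])
      show "range (\<lambda>m. \<Inter>n\<in>{m..}. crowded b (s j) n) \<subseteq> sets lborel"
        by (intro image_subsetI) measurable
    qed (auto simp: incseq_def)
    also have "\<dots> \<le> ennreal (K * s j)"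
      by (intro SUP_least order.trans[OF emeasure_mono le[of j]]) auto
    finally show ?thesis .
  qed
  have "(\<lambda>j. ennreal (K * s j)) \<longlonglongrightarrow> ennreal (K * 0)"
    by (intro tendsto_ennrealI tendsto_mult tendsto_const s_lim)
  moreover have "emeasure lborel (\<Inter>j. E j) \<le> ennreal (K * s j)" for j
    by (rule order.trans[OF emeasure_mono E_le[of j]]) auto
  ultimately have "emeasure lborel (\<Inter>j. E j) \<le> 0"
    by (intro LIMSEQ_le_const[where X = "\<lambda>j. ennreal (K * s j)"]) auto
  then have "(\<Inter>j. E j) \<in> null_sets lborel" by (auto simp: null_sets_def)
  then show ?thesis
  proof (rule AE_I')
    show "{\<beta> \<in> space lborel. \<not> (\<beta> \<in> {beta_BS..b} \<longrightarrow> (\<exists>s>0. \<forall>m. \<exists>n\<ge>m. \<beta> \<notin> crowded b s n))} \<subseteq> (\<Inter>j. E j)"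
    proof (intro subsetI INT_I)
      fix \<beta> j
      assume "\<beta> \<in> {\<beta> \<in> space lborel. \<not> (\<beta> \<in> {beta_BS..b} \<longrightarrow> (\<exists>s>0. \<forall>m. \<exists>n\<ge>m. \<beta> \<notin> crowded b s n))}"
      then have "\<forall>s>0. \<not> (\<forall>m. \<exists>n\<ge>m. \<beta> \<notin> crowded b s n)" by simp
      from this[rule_format, OF s[of j]] show "\<beta> \<in> E j" by (auto simp: E_def)
    qed
  qed
qed

section \<open>The level sets and their limsup for a fixed parameter\<close>

definition level :: "real \<Rightarrow> real \<Rightarrow> nat \<Rightarrow> real set" where
  "level \<beta> s n = (\<Union>xs\<in>words n. {(\<beta> - 1) * pt \<beta> xs .. (\<beta> - 1) * pt \<beta> xs + s / 2 ^ n})"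

definition limsup_level :: "real \<Rightarrow> real \<Rightarrow> real set" where
  "limsup_level \<beta> s = (\<Inter>m. \<Union>n\<in>{m..}. level \<beta> s n)"

lemma sets_level [measurable]: "level \<beta> s n \<in> sets borel"
  unfolding level_def by (intro sets.finite_UN) auto

lemma sets_limsup_level [measurable]: "limsup_level \<beta> s \<in> sets borel"
  unfolding limsup_level_def by measurable

text \<open>Every word outside \<open>I\<close> is the first component of a close pair, so at least
  half of the words lie in \<open>I\<close>. Their intervals are disjoint and of length
  \<open>s / 2 ^ n\<close>, with total length at least \<open>s / 2\<close>.\<close>

lemma emeasure_level_ge:
  assumes \<beta>: "1 < \<beta>" and s: "0 < s" and few: "real (card (close_pairs s n \<beta>)) < 2 ^ n / 2"
  shows "ennreal (s / 2) \<le> emeasure lborel (level \<beta> s n)"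
proof -
  define I where "I = {xs \<in> words n. \<forall>ys\<in>words n. ys \<noteq> xs \<longrightarrow> s / 2 ^ n < (\<beta> - 1) * \<bar>pt \<beta> xs - pt \<beta> ys\<bar>}"
  let ?J = "\<lambda>xs. {(\<beta> - 1) * pt \<beta> xs .. (\<beta> - 1) * pt \<beta> xs + s / 2 ^ n}"
  have I: "I \<subseteq> words n" "finite I" using finite_subset[of I "words n"] by (auto simp: I_def)
  have "words n - I \<subseteq> fst ` close_pairs s n \<beta>"
  proof
    fix xs assume "xs \<in> words n - I"
    then obtain ys where "xs \<in> words n" "ys \<in> words n" "ys \<noteq> xs"
      "\<not> s / 2 ^ n < (\<beta> - 1) * \<bar>pt \<beta> xs - pt \<beta> ys\<bar>"
      unfolding I_def by blast
    then have "(xs, ys) \<in> close_pairs s n \<beta>" by (simp add: close_pairs_def)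
    then show "xs \<in> fst ` close_pairs s n \<beta>" by (rule image_eqI[rotated]) simp
  qed
  then have "card (words n - I) \<le> card (close_pairs s n \<beta>)"
    by (meson card_image_le card_mono finite_close_pairs finite_imageI order.trans)
  then have "2 ^ n \<le> card I + card (close_pairs s n \<beta>)"
    using I by (simp add: card_Diff_subset)
  then have "real (2 ^ n) \<le> real (card I + card (close_pairs s n \<beta>))" by (simp only: of_nat_le_iff)
  then have "2 ^ n / 2 \<le> real (card I)" using few by simp
  then have "s / 2 \<le> real (card I) * (s / 2 ^ n)"
    using mult_right_mono[of "2 ^ n / 2" "real (card I)" "s / 2 ^ n"] s by simp
  then have "ennreal (s / 2) \<le> ennreal (real (card I) * (s / 2 ^ n))" by (rule ennreal_leI)
  also have "\<dots> = (\<Sum>xs\<in>I. emeasure lborel (?J xs))"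
  proof -
    have "emeasure lborel (?J xs) = ennreal (s / 2 ^ n)" for xs
      using s by (subst emeasure_lborel_Icc) auto
    then show ?thesis
      using s by (subst ennreal_mult') (auto simp: ennreal_of_nat_eq_real_of_nat)
  qed
  also have "\<dots> = emeasure lborel (\<Union>xs\<in>I. ?J xs)"
  proof (rule sum_emeasure)
    show "disjoint_family_on ?J I"
    proof (unfold disjoint_family_on_def, intro ballI impI)
      fix xs ys assume "xs \<in> I" "ys \<in> I" "xs \<noteq> ys"
      then have "s / 2 ^ n < (\<beta> - 1) * \<bar>pt \<beta> xs - pt \<beta> ys\<bar>" by (auto simp: I_def)
      also have "\<dots> = \<bar>(\<beta> - 1) * pt \<beta> xs - (\<beta> - 1) * pt \<beta> ys\<bar>"
        using \<beta> by (simp add: abs_mult flip: right_diff_distrib)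
      finally show "?J xs \<inter> ?J ys = {}" by auto
    qed
  qed (use I in auto)
  also have "\<dots> \<le> emeasure lborel (level \<beta> s n)"
    using I by (intro emeasure_mono) (auto simp: level_def)
  finally show ?thesis .
qed

lemma level_subset:
  assumes "1 < \<beta>"
  shows "level \<beta> s n \<subseteq> {0..1 + s / 2 ^ n}"
proof
  fix y assume "y \<in> level \<beta> s n"
  then obtain xs where "xs \<in> words n" "(\<beta> - 1) * pt \<beta> xs \<le> y" "y \<le> (\<beta> - 1) * pt \<beta> xs + s / 2 ^ n"
    by (auto simp: level_def)
  moreover from this have "0 \<le> (\<beta> - 1) * pt \<beta> xs" "(\<beta> - 1) * pt \<beta> xs \<le> 1"
    using pt_bounds[OF assms, of xs] by (simp_all add: words_def)
  ultimately show "y \<in> {0..1 + s / 2 ^ n}" by simp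
qed

lemma limsup_level_subset:
  assumes "1 < \<beta>" "0 \<le> s"
  shows "limsup_level \<beta> s \<subseteq> {0..1}"
proof
  fix y assume y: "y \<in> limsup_level \<beta> s"
  then have mem: "\<exists>n\<ge>m. y \<in> {0..1 + s / 2 ^ n}" for m
    using level_subset[OF assms(1), of s] unfolding limsup_level_def by blast
  have "y \<le> 1"
  proof (rule ccontr)
    assume "\<not> y \<le> 1"
    have "(\<lambda>n. s * (1 / 2) ^ n) \<longlonglongrightarrow> s * 0" by (intro tendsto_mult tendsto_const LIMSEQ_power_zero) auto
    then have "eventually (\<lambda>n. s * (1 / 2) ^ n < y - 1) sequentially"
      using \<open>\<not> y \<le> 1\<close> by (intro order_tendstoD) auto
    then obtain m where m: "\<And>n. n \<ge> m \<Longrightarrow> s * (1 / 2) ^ n < y - 1" unfolding eventually_sequentially by blast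
    obtain n where "n \<ge> m" "y \<le> 1 + s / 2 ^ n" using mem[of m] by auto
    then show False using m[of n] by (simp add: power_one_over)
  qed
  moreover have "0 \<le> y" using mem[of 0] by auto
  ultimately show "y \<in> {0..1}" by simp
qed

text \<open>Continuity from above: each tail union contains an uncrowded level, and all of them lie
  in the bounded interval \<open>[0, 1 + s]\<close>.\<close>

lemma emeasure_limsup_level_ge:
  assumes \<beta>: "1 < \<beta>" and s: "0 < s" and few: "\<forall>m. \<exists>n\<ge>m. real (card (close_pairs s n \<beta>)) < 2 ^ n / 2"
  shows "ennreal (s / 2) \<le> emeasure lborel (limsup_level \<beta> s)"
proof -
  have "level \<beta> s n \<subseteq> {0..1 + s}" for n
  proof -
    have "s * 1 \<le> s * 2 ^ n" using s by (intro mult_left_mono) auto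
    then have "s / 2 ^ n \<le> s" by (simp add: divide_le_eq)
    then have "{0..1 + s / 2 ^ n} \<subseteq> {0..1 + s}" by simp
    then show ?thesis using level_subset[OF \<beta>, of s n] by (rule subset_trans[rotated])
  qed
  then have sub: "(\<Union>n\<in>{m..}. level \<beta> s n) \<subseteq> {0..1 + s}" for m
    by (rule UN_least)
  have "ennreal (s / 2) \<le> (INF m. emeasure lborel (\<Union>n\<in>{m..}. level \<beta> s n))"
  proof (rule INF_greatest)
    fix m
    obtain n where n: "n \<ge> m" "real (card (close_pairs s n \<beta>)) < 2 ^ n / 2" using few by auto
    have "ennreal (s / 2) \<le> emeasure lborel (level \<beta> s n)" using emeasure_level_ge[OF \<beta> s n(2)] .
    also have "\<dots> \<le> emeasure lborel (\<Union>n\<in>{m..}. level \<beta> s n)" using n by (intro emeasure_mono) auto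
    finally show "ennreal (s / 2) \<le> emeasure lborel (\<Union>n\<in>{m..}. level \<beta> s n)" .
  qed
  also have "\<dots> = emeasure lborel (limsup_level \<beta> s)"
    unfolding limsup_level_def
  proof (rule INF_emeasure_decseq)
    show "emeasure lborel (\<Union>n\<in>{m..}. level \<beta> s n) \<noteq> \<infinity>" for m
      using emeasure_mono[OF sub[of m], of lborel] s by (auto simp: top_unique)
  qed (auto simp: decseq_def intro!: bexI)
  finally show ?thesis .
qed

section \<open>From positive to full measure\<close>

text \<open>The two digit maps send \<open>[0, 1]\<close> onto \<open>[0, 1 / \<beta>]\<close> and
  \<open>[1 - 1 / \<beta>, 1]\<close>, which cover \<open>[0, 1]\<close> because
  \<open>\<beta> < 2\<close>. Following an expansion of \<open>x\<close> for \<open>m\<close> digits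
  composes them into an affine copy of \<open>[0, 1]\<close> around \<open>x\<close> that carries
  \<open>E\<close> into itself.\<close>

lemma affine_copy_containing:
  fixes \<beta> :: real
  assumes \<beta>: "1 < \<beta>" "\<beta> < 2"
    and inv: "\<And>a y. a \<in> {0, 1} \<Longrightarrow> y \<in> E \<Longrightarrow> (y + a * (\<beta> - 1)) / \<beta> \<in> E"
  shows "x \<in> {0..1} \<Longrightarrow> \<exists>t\<ge>0. t \<le> x \<and> x \<le> t + 1 / \<beta> ^ m \<and> t + 1 / \<beta> ^ m \<le> 1 \<and> (\<forall>y\<in>E. t + y / \<beta> ^ m \<in> E)"
proof (induction m arbitrary: x)
  case 0
  then show ?case by (intro exI[of _ 0]) auto
next
  case (Suc m)
  obtain a :: real where a: "a \<in> {0, 1}" "\<beta> * x - a * (\<beta> - 1) \<in> {0..1}"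
  proof (cases "\<beta> * x \<le> 1")
    case True
    then show ?thesis using that[of 0] Suc.prems \<beta> by auto
  next
    \<comment> \<open>Digit \<open>1\<close> is admissible because
      \<open>\<beta> * x > 1 > \<beta> - 1\<close>.\<close>
    case False
    have "\<beta> * x \<le> \<beta> * 1" using Suc.prems \<beta> by (intro mult_left_mono) auto
    then show ?thesis using that[of 1] False \<beta> by auto
  qed
  obtain t where t: "t \<ge> 0" "t \<le> \<beta> * x - a * (\<beta> - 1)" "\<beta> * x - a * (\<beta> - 1) \<le> t + 1 / \<beta> ^ m"
    "t + 1 / \<beta> ^ m \<le> 1" "\<forall>y\<in>E. t + y / \<beta> ^ m \<in> E"
    using Suc.IH[OF a(2)] by auto
  have eq: "(t + a * (\<beta> - 1)) / \<beta> + y / \<beta> ^ Suc m = (t + y / \<beta> ^ m + a * (\<beta> - 1)) / \<beta>" for y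
    using \<beta> by (simp add: add_divide_distrib)
  show ?case
  proof (intro exI[of _ "(t + a * (\<beta> - 1)) / \<beta>"] conjI ballI)
    show "0 \<le> (t + a * (\<beta> - 1)) / \<beta>" using t a \<beta> by auto
    show "(t + a * (\<beta> - 1)) / \<beta> \<le> x" using t \<beta> by (simp add: divide_le_eq mult.commute)
    show "x \<le> (t + a * (\<beta> - 1)) / \<beta> + 1 / \<beta> ^ Suc m"
      unfolding eq using t \<beta> by (simp add: le_divide_eq mult.commute)
    have "a * (\<beta> - 1) \<le> \<beta> - 1" using a \<beta> by auto
    then have "t + 1 / \<beta> ^ m + a * (\<beta> - 1) \<le> \<beta>" using t by linarith
    then show "(t + a * (\<beta> - 1)) / \<beta> + 1 / \<beta> ^ Suc m \<le> 1"
      unfolding eq using \<beta> by simp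
    show "(t + a * (\<beta> - 1)) / \<beta> + y / \<beta> ^ Suc m \<in> E" if "y \<in> E" for y
      unfolding eq using t that a inv by blast
  qed
qed

text \<open>A copy of \<open>[0, 1]\<close> through the midpoint, of length at most half of
  \<open>r - l\<close>, stays inside \<open>[l, r]\<close> and brings along a scaled copy of
  \<open>E\<close>.\<close>

lemma measure_Int_interval_ge:
  fixes \<beta> :: real
  assumes \<beta>: "1 < \<beta>" "\<beta> < 2" and E: "E \<in> sets lebesgue" "E \<subseteq> {0..1}"
    and inv: "\<And>a y. a \<in> {0, 1} \<Longrightarrow> y \<in> E \<Longrightarrow> (y + a * (\<beta> - 1)) / \<beta> \<in> E"
    and lr: "0 \<le> l" "l < r" "r \<le> 1"
  shows "measure lebesgue E / 4 * (r - l) \<le> measure lebesgue (E \<inter> {l..r})"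
proof -
  define d where "d = (r - l) / 2"
  have d: "0 < d" "d < 1" using lr by (auto simp: d_def)
  have "(\<lambda>m. (1 / \<beta>) ^ m) \<longlonglongrightarrow> 0" using \<beta> by (intro LIMSEQ_power_zero) auto
  then have "eventually (\<lambda>m. (1 / \<beta>) ^ m < d) sequentially" using d by (intro order_tendstoD) auto
  then have ex: "\<exists>m. 1 / \<beta> ^ m \<le> d"
    by (auto simp: eventually_sequentially power_one_over intro: less_imp_le)
  \<comment> \<open>By minimality the previous power exceeds \<open>d\<close>, so
    \<open>\<beta> < 2\<close> keeps \<open>1 / \<beta> ^ m\<close> above
    \<open>d / 2 = (r - l) / 4\<close>. Since \<open>d < 1\<close>, \<open>m\<close> is not
    \<open>0\<close>.\<close>
  define m where "m = (LEAST m. 1 / \<beta> ^ m \<le> d)"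
  have m: "1 / \<beta> ^ m \<le> d" unfolding m_def using ex by (rule LeastI_ex)
  then obtain k where k: "m = Suc k" using d by (cases m) auto
  have "\<not> 1 / \<beta> ^ k \<le> d"
    using not_less_Least[of k "\<lambda>m. 1 / \<beta> ^ m \<le> d"] k by (simp add: m_def)
  then have "d / 2 \<le> (1 / \<beta> ^ k) * (1 / \<beta>)"
    using \<beta> d mult_mono[of d "1 / \<beta> ^ k" "1 / 2" "1 / \<beta>"] by auto
  then have m2: "d / 2 \<le> 1 / \<beta> ^ m" by (simp add: k mult.commute)
  obtain t where t: "t \<ge> 0" "t \<le> (l + r) / 2" "(l + r) / 2 \<le> t + 1 / \<beta> ^ m"
    "t + 1 / \<beta> ^ m \<le> 1" "\<forall>y\<in>E. t + y / \<beta> ^ m \<in> E"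
    using affine_copy_containing[OF \<beta> inv, where x = "(l + r) / 2" and m = m] lr by auto
  have sub: "(\<lambda>y. (1 / \<beta> ^ m) *\<^sub>R y + t) ` E \<subseteq> E \<inter> {l..r}"
  proof safe
    fix y assume y: "y \<in> E"
    then have y01: "0 \<le> y" "y \<le> 1" using E by auto
    show "(1 / \<beta> ^ m) *\<^sub>R y + t \<in> E" using t y by (simp add: add.commute)
    have "0 \<le> (1 / \<beta> ^ m) * y" "(1 / \<beta> ^ m) * y \<le> 1 / \<beta> ^ m"
      using y01 \<beta> by (auto simp: divide_right_mono)
    then show "(1 / \<beta> ^ m) *\<^sub>R y + t \<in> {l..r}" using t m by (auto simp: d_def field_simps)
  qed
  have Em: "E \<in> lmeasurable" using E by (metis bounded_closed_interval bounded_set_imp_lmeasurable bounded_subset)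
  have "measure lebesgue E / 4 * (r - l) = measure lebesgue E * (d / 2)" by (simp add: d_def)
  also have "\<dots> \<le> measure lebesgue E * (1 / \<beta> ^ m)" using m2 by (intro mult_left_mono) auto
  also have "\<dots> = measure lebesgue ((\<lambda>y. (1 / \<beta> ^ m) *\<^sub>R y + t) ` E)"
    using \<beta> by (subst measure_lebesgue_affine) auto
  also have "\<dots> \<le> measure lebesgue (E \<inter> {l..r})"
  proof (rule measure_mono_fmeasurable[OF sub])
    show "(\<lambda>y. (1 / \<beta> ^ m) *\<^sub>R y + t) ` E \<in> sets lebesgue"
    proof (rule differentiable_image_in_sets_lebesgue[OF E(1)])
      have "((\<lambda>y. (1 / \<beta> ^ m) *\<^sub>R y + t) has_derivative (\<lambda>y. (1 / \<beta> ^ m) *\<^sub>R y)) (at y within E)" for y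
        by (rule derivative_eq_intros refl)+ simp
      then show "(\<lambda>y. (1 / \<beta> ^ m) *\<^sub>R y + t) differentiable_on E"
        unfolding differentiable_on_def differentiable_def by blast
    qed simp
    show "E \<inter> {l..r} \<in> lmeasurable" using Em by (simp add: fmeasurable.Int)
  qed
  finally show ?thesis .
qed

text \<open>Enclose the complement \<open>U\<close> in an open \<open>T\<close> with
  \<open>T - U\<close> of measure below \<open>\<epsilon>\<close>, and cover \<open>U\<close> by
  nonoverlapping intervals inside \<open>T\<close>. Their parts in \<open>E\<close> lie in
  \<open>T - U\<close>, so the density bound limits their total length to
  \<open>\<epsilon> / \<kappa>\<close>.\<close>

lemma full_measure_if_dense_in_intervals:
  fixes E :: "real set"
  assumes E: "E \<in> sets lebesgue" "E \<subseteq> {0..1}" and \<kappa>: "0 < \<kappa>"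
    and dense: "\<And>l r. \<lbrakk>0 \<le> l; l < r; r \<le> 1\<rbrakk> \<Longrightarrow> \<kappa> * (r - l) \<le> measure lebesgue (E \<inter> {l..r})"
  shows "{0..1} - E \<in> null_sets lebesgue"
proof -
  define U where "U = {0..1} - E"
  have U: "U \<in> sets lebesgue" unfolding U_def using E by auto
  have Em: "E \<in> lmeasurable" using E by (metis bounded_closed_interval bounded_set_imp_lmeasurable bounded_subset)
  have Um: "U \<in> lmeasurable" using U by (metis Diff_subset U_def bounded_closed_interval bounded_set_imp_lmeasurable bounded_subset)
  have "measure lebesgue U \<le> \<epsilon> / \<kappa>" if \<epsilon>: "0 < \<epsilon>" for \<epsilon>
  proof -
    obtain T where T: "open T" "U \<subseteq> T" "T - U \<in> lmeasurable" "emeasure lebesgue (T - U) < ennreal \<epsilon>"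
      using sets_lebesgue_outer_open[OF U \<epsilon>] .
    have TU: "measure lebesgue (T - U) \<le> \<epsilon>"
      using T \<epsilon> by (simp add: emeasure_eq_measure2 ennreal_less_iff)
    \<comment> \<open>The covering lemma tags its intervals by points of \<open>U\<close>, where
      \<open>g\<close> is \<open>T\<close>; the value \<open>UNIV\<close> elsewhere only makes
      \<open>g\<close> a gauge.\<close>
    define g where "g x = (if x \<in> T then T else UNIV)" for x
    have g: "gauge g" using T by (auto simp: g_def gauge_def)
    have U01: "U \<subseteq> cbox 0 1" "box (0 :: real) 1 \<noteq> {}" by (auto simp: U_def)
    obtain \<D> where D: "countable \<D>" "\<Union>\<D> \<subseteq> cbox 0 1"
      "\<And>K. K \<in> \<D> \<Longrightarrow> interior K \<noteq> {} \<and> (\<exists>c d. K = cbox c d)"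
      "pairwise (\<lambda>A B. interior A \<inter> interior B = {}) \<D>"
      "\<And>K. K \<in> \<D> \<Longrightarrow> \<exists>x \<in> U \<inter> K. K \<subseteq> g x" "U \<subseteq> \<Union>\<D>"
      using covering_lemma[OF U01 g] by metis
    have K: "\<exists>c d. K = {c..d} \<and> 0 \<le> c \<and> c < d \<and> d \<le> 1 \<and> K \<subseteq> T" if KD: "K \<in> \<D>" for K
    proof -
      obtain c d where cd: "K = cbox c d" "interior K \<noteq> {}" using D(3) KD by blast
      then have "c < d" by auto
      moreover have "K \<subseteq> cbox 0 1" using D(2) KD by blast
      moreover have "K \<subseteq> T" 
      proof -
        obtain x where "x \<in> U" "K \<subseteq> g x" using D(5)[OF KD] by blast
        moreover have "g x = T" using \<open>x \<in> U\<close> T(2) by (auto simp: g_def)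
        ultimately show ?thesis by simp
      qed
      ultimately show ?thesis using cd by auto
    qed
    have Klm: "K \<in> lmeasurable" if "K \<in> \<D>" for K using K[OF that] by auto
    \<comment> \<open>the intervals in \<open>\<D>\<close> lie in \<open>T\<close>, so their \<open>\<kappa>\<close>-portion in \<open>E\<close> lies in the small set \<open>T - U\<close>\<close>
    have fin: "measure lebesgue (\<Union>\<F>) \<le> \<epsilon> / \<kappa>" if F: "\<F> \<subseteq> \<D>" "finite \<F>" for \<F>
    proof -
      have "\<kappa> * measure lebesgue (\<Union>\<F>) \<le> \<kappa> * (\<Sum>K\<in>\<F>. measure lebesgue K)"
        using measure_Union_le[of \<F> lebesgue] F Klm \<kappa> by (intro mult_left_mono) (auto intro!: fmeasurableD)
      also have "\<dots> \<le> (\<Sum>K\<in>\<F>. measure lebesgue (E \<inter> K))"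
        unfolding sum_distrib_left
      proof (rule sum_mono)
        fix K assume "K \<in> \<F>"
        then have "K \<in> \<D>" using F by blast
        then obtain c d where "K = {c..d}" "0 \<le> c" "c < d" "d \<le> 1" using K by blast
        then show "\<kappa> * measure lebesgue K \<le> measure lebesgue (E \<inter> K)"
          using dense[of c d] by simp
      qed
      also have "\<dots> = measure lebesgue (\<Union>K\<in>\<F>. E \<inter> K)"
      \<comment> \<open>The intervals may share endpoints, so additivity holds only up to negligible
        overlaps.\<close>
      proof (rule measure_negligible_finite_Union_image[symmetric])
        show "pairwise (\<lambda>K L. negligible (E \<inter> K \<inter> (E \<inter> L))) \<F>"
        proof (rule pairwiseI)
          fix K L assume KL: "K \<in> \<F>" "L \<in> \<F>" "K \<noteq> L"
          then have KL': "K \<in> \<D>" "L \<in> \<D>" using F by auto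
          obtain a b where a: "K = {a..b}" using K[OF KL'(1)] by blast
          obtain c d where c: "L = {c..d}" using K[OF KL'(2)] by blast
          note ab = a c
          have "interior K \<inter> interior L = {}" using D(4) KL F by (auto simp: pairwise_def)
          then have "{a<..<b} \<inter> {c<..<d} = {}" by (simp add: ab)
          then have "{max a c<..<min b d} = {}" by auto
          then have "negligible {max a c..min b d}"
            using negligible_interval(1)[of "max a c" "min b d"] by (simp only: box_real)
          then have "negligible ({a..b} \<inter> {c..d})" by (simp only: Int_atLeastAtMost sup_max inf_min)
          then show "negligible (E \<inter> K \<inter> (E \<inter> L))"
            by (rule negligible_subset) (auto simp: ab)
        qed
      qed (use F Em Klm in \<open>auto intro: fmeasurable.Int\<close>)
      also have "\<dots> \<le> measure lebesgue (T - U)"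
      proof (rule measure_mono_fmeasurable)
        show "(\<Union>K\<in>\<F>. E \<inter> K) \<subseteq> T - U" using K F by (fastforce simp: U_def)
        show "(\<Union>K\<in>\<F>. E \<inter> K) \<in> sets lebesgue"
          using F Em Klm by (intro sets.finite_UN) (auto intro!: fmeasurableD)
      qed (use T in auto)
      also have "\<dots> \<le> \<epsilon>" by (rule TU)
      finally show ?thesis using \<kappa> by (simp add: field_simps)
    qed
    have "\<Union>\<D> \<in> lmeasurable" "measure lebesgue (\<Union>\<D>) \<le> \<epsilon> / \<kappa>"
      by (rule fmeasurable_Union_bound[OF D(1) Klm fin] measure_Union_bound[OF D(1) Klm fin]; assumption)+
    then show ?thesis using measure_mono_fmeasurable[OF D(6) U] by auto
  qed
  then have le: "measure lebesgue U * \<kappa> \<le> \<epsilon>" if "0 < \<epsilon>" for \<epsilon>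
    using that \<kappa> by (simp add: field_simps)
  have "measure lebesgue U * \<kappa> \<le> 0" by (rule field_le_epsilon) (simp add: le)
  then have "measure lebesgue U \<le> 0" using \<kappa> by (simp add: mult_le_0_iff)
  then have "measure lebesgue U = 0" by (simp add: measure_le_0_iff)
  then show ?thesis using Um by (simp add: U_def[symmetric] null_sets_def emeasure_eq_measure2 fmeasurableD)
qed

section \<open>Digit maps on the limsup sets and the passage to \<open>V\<close>\<close>

lemma limsup_level_mono:
  assumes "s \<le> t"
  shows "limsup_level \<beta> s \<subseteq> limsup_level \<beta> t"
proof -
  have "level \<beta> s n \<subseteq> level \<beta> t n" for n
    unfolding level_def using divide_right_mono[OF assms, of "2 ^ n"] by (intro UN_mono) auto
  then show ?thesis unfolding limsup_level_def by blast
qed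

text \<open>Prepending a digit moves an interval from level \<open>n\<close> to level
  \<open>n + 1\<close>, where the unit is half as large; \<open>1 / \<beta> < 1\<close> then gives
  \<open>2 * s\<close>. Hence only the union over all \<open>s\<close> is invariant.\<close>

lemma limsup_level_step:
  assumes \<beta>: "1 < \<beta>" and s: "0 \<le> s" and a: "a \<in> {0, 1}" and y: "y \<in> limsup_level \<beta> s"
  shows "(y + of_int a * (\<beta> - 1)) / \<beta> \<in> limsup_level \<beta> (2 * s)"
  unfolding limsup_level_def
proof (rule INT_I)
  fix m
  obtain n where n: "n \<ge> m" "y \<in> level \<beta> s n" using y by (auto simp: limsup_level_def)
  then obtain xs where xs: "xs \<in> words n" "(\<beta> - 1) * pt \<beta> xs \<le> y" "y \<le> (\<beta> - 1) * pt \<beta> xs + s / 2 ^ n"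
    by (auto simp: level_def)
  have pt: "(\<beta> - 1) * pt \<beta> (a # xs) = ((\<beta> - 1) * pt \<beta> xs + of_int a * (\<beta> - 1)) / \<beta>"
    by (simp add: algebra_simps)
  have "(y + of_int a * (\<beta> - 1)) / \<beta> \<le> ((\<beta> - 1) * pt \<beta> xs + of_int a * (\<beta> - 1) + s / 2 ^ n) / \<beta>"
    using xs \<beta> by (intro divide_right_mono) auto
  also have "\<dots> = (\<beta> - 1) * pt \<beta> (a # xs) + s / 2 ^ n / \<beta>"
    unfolding pt by (simp add: add_divide_distrib)
  also have "s / 2 ^ n / \<beta> \<le> s / 2 ^ n / 1"
    using s \<beta> by (intro divide_left_mono) auto
  also have "\<dots> = 2 * s / 2 ^ Suc n" by simp
  finally have "(y + of_int a * (\<beta> - 1)) / \<beta> \<le> (\<beta> - 1) * pt \<beta> (a # xs) + 2 * s / 2 ^ Suc n" by simp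
  moreover have "(\<beta> - 1) * pt \<beta> (a # xs) \<le> (y + of_int a * (\<beta> - 1)) / \<beta>"
    unfolding pt using xs \<beta> by (intro divide_right_mono) auto
  moreover have "a # xs \<in> words (Suc n)" using a xs by (auto simp: words_def)
  ultimately have "(y + of_int a * (\<beta> - 1)) / \<beta> \<in> level \<beta> (2 * s) (Suc n)"
    unfolding level_def by (intro UN_I[of "a # xs"]) auto
  then show "(y + of_int a * (\<beta> - 1)) / \<beta> \<in> (\<Union>n\<in>{m..}. level \<beta> (2 * s) n)"
    using n by (intro UN_I[of "Suc n"]) auto
qed

text \<open>Translates lists, indexed from \<open>0\<close>, into the extensional words on
  \<open>{1..n}\<close> used by \<open>V\<close>.\<close>

lemma pt_eq_word_sum:
  assumes "length xs = n"
  shows "pt \<beta> xs = (\<Sum>i=1..n. (\<lambda>i\<in>{1..n}. of_int (xs ! (i - 1))) i / \<beta> ^ i)"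
  unfolding pt_eq_sum assms One_nat_def sum.atLeast1_atMost_eq
  by (auto simp: sum_divide_distrib power_one_over field_simps intro!: sum.cong)

lemma limsup_level_subset_V:
  assumes "filterlim \<omega> at_top sequentially"
  shows "limsup_level \<beta> s \<subseteq> V \<beta> (\<lambda>n. \<omega> n * 2 powi (- int n))"
proof
  fix y assume y: "y \<in> limsup_level \<beta> s"
  obtain N where N: "\<And>n. n \<ge> N \<Longrightarrow> s \<le> \<omega> n"
    using assms unfolding filterlim_at_top eventually_sequentially by blast
  show "y \<in> V \<beta> (\<lambda>n. \<omega> n * 2 powi (- int n))"
    unfolding V_def
  proof (rule INT_I)
    fix m :: nat
    obtain n where n: "n \<ge> max m N" "y \<in> level \<beta> s n"
      using y unfolding limsup_level_def by blast
    then obtain xs where xs: "xs \<in> words n" "(\<beta> - 1) * pt \<beta> xs \<le> y" "y \<le> (\<beta> - 1) * pt \<beta> xs + s / 2 ^ n"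
      by (auto simp: level_def)
    define \<epsilon> where "\<epsilon> = (\<lambda>i\<in>{1..n}. real_of_int (xs ! (i - 1)))"
    have len: "length xs = n" "set xs \<subseteq> {0, 1}" using xs by (auto simp: words_def)
    have "xs ! (i - 1) \<in> {0, 1}" if "i \<in> {1..n}" for i
    proof -
      have "i - 1 < length xs" using that len by auto
      then show ?thesis using len(2) nth_mem by blast
    qed
    then have \<epsilon>: "\<epsilon> \<in> {1..n} \<rightarrow>\<^sub>E {0, 1}" unfolding \<epsilon>_def by fastforce
    have "s / 2 ^ n \<le> \<omega> n / 2 ^ n" using N[of n] n by (intro divide_right_mono) auto
    also have "\<dots> = \<omega> n * 2 powi (- int n)" by (simp add: power_int_minus divide_inverse)
    finally have "y \<in> {(\<beta> - 1) * (\<Sum>i=1..n. \<epsilon> i / \<beta> ^ i) .. (\<beta> - 1) * (\<Sum>i=1..n. \<epsilon> i / \<beta> ^ i) + \<omega> n * 2 powi (- int n)}"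
      using xs unfolding pt_eq_word_sum[OF len(1)] \<epsilon>_def by simp
    then show "y \<in> (\<Union>n\<in>{m..}. \<Union>\<epsilon>\<in>{1..n} \<rightarrow>\<^sub>E {0, 1}.
        {(\<beta> - 1) * (\<Sum>i=1..n. \<epsilon> i / \<beta> ^ i) .. (\<beta> - 1) * (\<Sum>i=1..n. \<epsilon> i / \<beta> ^ i) + \<omega> n * 2 powi (- int n)})"
      using n \<epsilon> by (intro UN_I[of n] UN_I[of \<epsilon>]) auto
  qed
qed

lemma emeasure_V_full:
  assumes \<beta>: "1 < \<beta>" "\<beta> < 2" and \<omega>: "filterlim \<omega> at_top sequentially"
    and s: "0 < s" and few: "\<forall>m. \<exists>n\<ge>m. real (card (close_pairs s n \<beta>)) < 2 ^ n / 2"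
  shows "emeasure lebesgue (V \<beta> (\<lambda>n. \<omega> n * 2 powi (- int n)) \<inter> {0..1}) = emeasure lebesgue {0..1::real}"
proof -
  let ?V = "V \<beta> (\<lambda>n. \<omega> n * 2 powi (- int n))"
  \<comment> \<open>Integer values of \<open>s\<close> keep the union countable, hence Borel; they
    suffice by monotonicity, and doubling \<open>k\<close> stays among them.\<close>
  define E where "E = (\<Union>k::nat. limsup_level \<beta> (real k))"
  have E_meas: "E \<in> sets borel" unfolding E_def by measurable
  have E01: "E \<subseteq> {0..1}"
    unfolding E_def by (intro UN_least limsup_level_subset \<beta>) auto
  have E: "E \<in> sets lebesgue" "E \<subseteq> {0..1}" using E_meas E01 by auto
  have "E \<in> lmeasurable" using E by (metis bounded_closed_interval bounded_set_imp_lmeasurable bounded_subset)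
  moreover have "limsup_level \<beta> s \<subseteq> E"
    using limsup_level_mono[of s "real (nat \<lceil>s\<rceil>)" \<beta>] real_nat_ceiling_ge[of s] unfolding E_def by blast
  then have "ennreal (s / 2) \<le> emeasure lborel E"
    using E_meas by (intro order.trans[OF emeasure_limsup_level_ge[OF \<beta>(1) s few] emeasure_mono]) auto
  then have "ennreal (s / 2) \<le> emeasure lebesgue E" using E_meas by simp
  ultimately have pos: "0 < measure lebesgue E"
    using s by (simp add: emeasure_eq_measure2)
  have inv: "(y + a * (\<beta> - 1)) / \<beta> \<in> E" if a: "a \<in> {0, 1}" and y: "y \<in> E" for a y :: real
  proof -
    obtain k where "y \<in> limsup_level \<beta> (real k)" using y by (auto simp: E_def)
    then have "(y + of_int b * (\<beta> - 1)) / \<beta> \<in> limsup_level \<beta> (real (2 * k))" if "b \<in> {0, 1}" for b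
      using limsup_level_step[OF \<beta>(1) _ that, of "real k" y] by simp
    from this[of 0] this[of 1] have "(y + a * (\<beta> - 1)) / \<beta> \<in> limsup_level \<beta> (real (2 * k))"
      using a by auto
    then show ?thesis unfolding E_def by (rule UN_I[OF UNIV_I])
  qed
  have "{0..1} - E \<in> null_sets lebesgue"
  proof (rule full_measure_if_dense_in_intervals[OF E])
    show "measure lebesgue E / 4 * (r - l) \<le> measure lebesgue (E \<inter> {l..r})"
      if "0 \<le> l" "l < r" "r \<le> 1" for l r
      by (rule measure_Int_interval_ge[OF \<beta> E inv that])
  qed (use pos in simp)
  moreover have "{0..1} - ?V \<subseteq> {0..1} - E"
    using limsup_level_subset_V[OF \<omega>, of \<beta>] by (auto simp: E_def)
  \<comment> \<open>Completeness of Lebesgue measure also supplies the measurability of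
    \<open>V\<close> within \<open>[0, 1]\<close>.\<close>
  ultimately have "{0..1} - ?V \<in> null_sets lebesgue"
    by (rule null_sets_completion_subset[rotated])
  then have "emeasure lebesgue ({0..1} - ({0..1} - ?V)) = emeasure lebesgue {0..1::real}"
    by (intro emeasure_Diff_null_set) auto
  moreover have "{0..1} - ({0..1} - ?V) = ?V \<inter> {0..1}" by auto
  ultimately show ?thesis by simp
qed

theorem theorem2p1:
  fixes \<omega> :: "nat \<Rightarrow> real"
  assumes "filterlim \<omega> at_top sequentially"
  shows "AE \<beta>\<in>{beta_BS<..<2} in lebesgue.
    emeasure lebesgue (V \<beta> (\<lambda>n. \<omega> n * 2 powi (- int n)) \<inter> {0..1}) = emeasure lebesgue {0..1::real}"
proof -
  \<comment> \<open>The bound \<open>b / (2 - b)\<close> blows up at \<open>2\<close>, so the range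
    is exhausted by countably many intervals \<open>[beta_BS, b j]\<close>; already
    \<open>b 0 = 3 / 2\<close> exceeds \<open>beta_BS\<close>.\<close>
  define b where "b j = 2 - 1 / (real j + 2)" for j
  have b: "beta_BS \<le> b j" "b j < 2" for j
  proof -
    have "1 / (real j + 2) \<le> 1 / 2" by (intro divide_left_mono) auto
    moreover have "beta_BS \<le> 3 / 2" using beta_BS_bounds by simp
    ultimately show "beta_BS \<le> b j" unfolding b_def by linarith
  qed (simp add: b_def)
  have "AE \<beta> in lborel. \<forall>j. \<beta> \<in> {beta_BS..b j} \<longrightarrow> (\<exists>s>0. \<forall>m. \<exists>n\<ge>m. \<beta> \<notin> crowded (b j) s n)"
    using AE_not_crowded[OF b] by (simp add: AE_all_countable)
  then have "AE \<beta> in lebesgue. \<forall>j. \<beta> \<in> {beta_BS..b j} \<longrightarrow> (\<exists>s>0. \<forall>m. \<exists>n\<ge>m. \<beta> \<notin> crowded (b j) s n)"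
    by (rule AE_completion)
  then show ?thesis
  proof (rule AE_mp, intro AE_I2 impI)
    fix \<beta> :: real
    assume ae: "\<forall>j. \<beta> \<in> {beta_BS..b j} \<longrightarrow> (\<exists>s>0. \<forall>m. \<exists>n\<ge>m. \<beta> \<notin> crowded (b j) s n)"
      and \<beta>: "\<beta> \<in> {beta_BS<..<2}"
    obtain j where "inverse (real (Suc j)) < 2 - \<beta>" using reals_Archimedean[of "2 - \<beta>"] \<beta> by auto
    moreover have "1 / (real j + 2) \<le> inverse (real (Suc j))" by (simp add: field_simps)
    ultimately have j: "\<beta> \<in> {beta_BS..b j}" using \<beta> by (simp add: b_def)
    then obtain s where "s > 0" "\<forall>m. \<exists>n\<ge>m. \<beta> \<notin> crowded (b j) s n" using ae by blast
    then have "\<forall>m. \<exists>n\<ge>m. real (card (close_pairs s n \<beta>)) < 2 ^ n / 2"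
      using j by (simp add: crowded_def not_le)
    then show "emeasure lebesgue (V \<beta> (\<lambda>n. \<omega> n * 2 powi (- int n)) \<inter> {0..1}) = emeasure lebesgue {0..1::real}"
      using \<beta> beta_BS_bounds \<open>s > 0\<close> assms by (intro emeasure_V_full) auto
  qed
qed

end
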